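(* Let $\Gamma\cup\{\psi\}$ be a set of $\mathcal{ML}(\subseteq)$-formulas. If $\Gamma\models\psi$, then $\Gamma\vdash\psi$, where $\vdash$ is derivability in the natural deduction system for modal inclusion logic $\mathcal{ML}(\subseteq)$.
   Context: SYNTAX. Fix a countably infinite set $\mathsf{Prop}$ of propositional symbols. Classical formulas ($\mathcal{ML}$): $\alpha::=p\mid\bot\mid\neg\alpha\mid(\alpha\lor\alpha)\mid(\alpha\land\alpha)\mid\Diamond\alpha\mid\Box\alpha$; $\top:=\neg\bot$. Letters $\alpha,\beta$ (with indices) always denote classical formulas. $\mathcal{ML}(\subseteq)$: $\phi::=p\mid\bot\mid(\alpha_1\dots\alpha_n\subseteq\beta_1\dots\beta_n)\mid\neg\alpha\mid(\phi\lor\phi)\mid(\phi\land\phi)\mid\Diamond\phi\mid\Box\phi$. Sans-serif $\mathsf{a},\mathsf{b},\mathsf{c}$ denote finite sequences of classical formulas ($|\mathsf{a}|$ is the length), the two sides of an inclusion atom always having the same length; $\mathsf{x}$ denotes a sequence of elements of $\{\top,\bot\}$, and $x$ an element of $\{\top,\bot\}$. $\alpha^\top:=\alpha$, $\alpha^\bot:=\neg\alpha$, and $\mathsf{a}^\mathsf{x}:=\alpha_1^{x_1}\land\dots\land\alpha_n^{x_n}$. SEMANTICS. A Kripke model is $M=(W,R,V)$ with $R\subseteq W\times W$ and $V$ assigning a subset of $W$ to each relevant propositional symbol; a team is a set $T\subseteq W$. $R[T]=\{v\mid\exists w\in T:wRv\}$, $R^{-1}[T]=\{w\mid\exists v\in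 T:wRv\}$; $TRS$ means $S\subseteq R[T]$ and $T\subseteq R^{-1}[S]$. $M,T\models p$ iff $T\subseteq V(p)$; $\models\bot$ iff $T=\emptyset$; $M,T\models\alpha_1\dots\alpha_n\subseteq\beta_1\dots\beta_n$ iff for all $w\in T$ there is $v\in T$ such that for all $i$, $M,\{w\}\models\alpha_i$ iff $M,\{v\}\models\beta_i$; $M,T\models\neg\alpha$ iff $M,\{w\}\not\models\alpha$ for all $w\in T$; $M,T\models\phi\lor\psi$ iff $T=T_1\cup T_2$ for some $T_1,T_2$ with $M,T_1\models\phi$, $M,T_2\models\psi$; $M,T\models\phi\land\psi$ iff both hold at $M,T$; $M,T\models\Diamond\phi$ iff $M,S\models\phi$ for some $S$ with $TRS$; $M,T\models\Box\phi$ iff $M,R[T]\models\phi$. $\Gamma\models\phi$ means: for all models $M$ and teams $T$ of $M$, if $M,T\models\gamma$ for all $\gamma\in\Gamma$ then $M,T\models\phi$. PROOF SYSTEM. $\Gamma\vdash\phi$ means that $\phi$ has a natural deduction derivation whose undischarged assumptions all lie in $\Gamma$. Equivalently, $\vdash$ is the least relation such that $\Gamma\vdash\phi$ whenever $\phi\in\Gamma$, and closed under the following rules. "$\phi_1,\dots,\phi_n\,/\,\psi$" means: if $\Gamma\vdash\phi_i$ for all $i$, then $\Gamma\vdash\psi$. $\Delta$ always denotes a set of classical formulas with $\Delta\subseteq\Gamma$. Classical rules: ($\neg$I) if $\Delta\cup\{\alpha\}\vdash\bot$ then $\Gamma\vdash\neg\alpha$. (RAA) if $\Delta\cup\{\neg\alpha\}\vdash\bot$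 then $\Gamma\vdash\alpha$. ($\neg$E) $\alpha,\neg\alpha\,/\,\phi$. ($\lor$I) $\phi\,/\,\phi\lor\psi$ and $\psi\,/\,\phi\lor\psi$. ($\lor$E) if $\Gamma\vdash\phi\lor\psi$, $\Delta\cup\{\phi\}\vdash\chi$ and $\Delta\cup\{\psi\}\vdash\chi$ then $\Gamma\vdash\chi$. ($\land$I) $\phi,\psi\,/\,\phi\land\psi$. ($\land$E) $\phi\land\psi\,/\,\phi$ and $\phi\land\psi\,/\,\psi$. ($\Diamond\Box$Inter) $\neg\Box\alpha\,/\,\Diamond\neg\alpha$. ($\Box\Diamond$Inter) $\Diamond\neg\alpha\,/\,\neg\Box\alpha$. ($\Diamond\lor$Distr) $\Diamond(\phi\lor\psi)\,/\,\Diamond\phi\lor\Diamond\psi$. ($\Box$Mon) if $\{\phi_1,\dots,\phi_n\}\vdash\psi$ and $\Gamma\vdash\Box\phi_i$ for $i=1,\dots,n$ then $\Gamma\vdash\Box\psi$ ($n\ge 0$). ($\Diamond$Mon) if $\{\phi\}\vdash\psi$ and $\Gamma\vdash\Diamond\phi$ then $\Gamma\vdash\Diamond\psi$. Inclusion rules: ($\subseteq$Id) $/\ \mathsf{a}\subseteq\mathsf{a}$. ($\subseteq$Exp) $\alpha^x,\ \mathsf{b}\subseteq\mathsf{c}\,/\,x\mathsf{b}\subseteq\alpha\mathsf{c}$. ($\subseteq_\neg$E) $\neg\mathsf{a}^\mathsf{x},\ \mathsf{x}\subseteq\mathsf{a}\,/\,\phi$. ($\lor_\subseteq$E) if $\Gamma\vdash\mathsf{x}\subseteq\mathsf{a}\lor\psi$,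 $\Gamma\cup\{\mathsf{x}\subseteq\mathsf{a}\}\vdash\chi$ and $\Gamma\cup\{\psi\}\vdash\chi$ then $\Gamma\vdash\chi$. ($\subseteq$Ext) $\bigwedge_{\mathsf{x}\in\{\top,\bot\}^{|\mathsf{a}|}}(\neg\mathsf{a}^\mathsf{x}\lor\mathsf{x}\subseteq\mathsf{b})\,/\,\mathsf{a}\subseteq\mathsf{b}$. ($\subseteq$Rdt) $\mathsf{a}\subseteq\mathsf{b}\,/\,\neg\mathsf{a}^\mathsf{x}\lor\mathsf{x}\subseteq\mathsf{b}$. ($\subseteq$Distr) $\phi\lor\psi,\ \mathsf{x}_1\subseteq\mathsf{a}_1,\dots,\mathsf{x}_n\subseteq\mathsf{a}_n\,/\,((\phi\lor\mathsf{a}_1^{\mathsf{x}_1}\lor\dots\lor\mathsf{a}_n^{\mathsf{x}_n})\land\mathsf{x}_1\subseteq\mathsf{a}_1\land\dots\land\mathsf{x}_n\subseteq\mathsf{a}_n)\lor\psi$. Modal inclusion rules: ($\Diamond_\subseteq$Distr) $\Diamond(\mathsf{x}\subseteq\mathsf{a})\,/\,\top\subseteq\Diamond\mathsf{a}^\mathsf{x}$. ($\Diamond\Box_\subseteq$Exc) $\top\subseteq\Diamond\mathsf{a}^\mathsf{x}\,/\,\Box(\mathsf{x}\subseteq\mathsf{a})$. ($\Box\Diamond_\subseteq$Exc) $\top\subseteq\Diamond\beta,\ \Box(\mathsf{x}\subseteq\mathsf{a})\,/\,\top\subseteq\Diamond\mathsf{a}^\mathsf{x}$. ($\Box\lor_\subseteq$E)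 if $\Gamma\vdash\Box(\mathsf{x}\subseteq\mathsf{a}\lor\psi)$, $\Gamma\cup\{\top\subseteq\Diamond\mathsf{a}^\mathsf{x}\}\vdash\chi$ and $\Gamma\cup\{\Box\psi\}\vdash\chi$ then $\Gamma\vdash\chi$. ($\subseteq_\Diamond$Distr) $\Diamond\phi,\ x_1\subseteq\Diamond\alpha_1,\dots,x_n\subseteq\Diamond\alpha_n\,/\,\Diamond((\phi\lor\alpha_1^{x_1}\lor\dots\lor\alpha_n^{x_n})\land x_1\subseteq\alpha_1\land\dots\land x_n\subseteq\alpha_n)$. *)

theory Defs
  imports Main "HOL-Library.Countable_Set"
begin

section \<open>Syntax\<close>

datatype 'p ml =
    CProp 'p
  | CBot
  | CNeg "'p ml"
  | COr "'p ml" "'p ml"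
  | CAnd "'p ml" "'p ml"
  | CDia "'p ml"
  | CBox "'p ml"

text \<open>
  \<open>Inc \<alpha>\<^sub>1 \<beta>\<^sub>1 [(\<alpha>\<^sub>2, \<beta>\<^sub>2), \<dots>, (\<alpha>\<^sub>n, \<beta>\<^sub>n)]\<close> is the inclusion atom
  \<open>\<alpha>\<^sub>1\<dots>\<alpha>\<^sub>n \<subseteq> \<beta>\<^sub>1\<dots>\<beta>\<^sub>n\<close>. Storing the two sides as pairs, the first one separately, makes
  them of equal length \<open>n \<ge> 1\<close> by construction.
\<close>

datatype 'p mli =
    Prop 'p
  | Bot
  | Inc "'p ml" "'p ml" "('p ml \<times> 'p ml) list"
  | Neg "'p ml"
  | Or "'p mli" "'p mli"
  | And "'p mli" "'p mli"
  | Dia "'p mli"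
  | Box "'p mli"

text \<open>The inclusion of the classical formulas into all formulas.\<close>

primrec cl :: "'p ml \<Rightarrow> 'p mli" where
  "cl (CProp p) = Prop p"
| "cl CBot = Bot"
| "cl (CNeg \<alpha>) = Neg \<alpha>"
| "cl (COr \<alpha> \<beta>) = Or (cl \<alpha>) (cl \<beta>)"
| "cl (CAnd \<alpha> \<beta>) = And (cl \<alpha>) (cl \<beta>)"
| "cl (CDia \<alpha>) = Dia (cl \<alpha>)"
| "cl (CBox \<alpha>) = Box (cl \<alpha>)"

text \<open>Only meaningful for nonempty lists of equal length; every use below ensures this.\<close>

definition incl :: "'p ml list \<Rightarrow> 'p ml list \<Rightarrow> 'p mli" where
  "incl a b = Inc (hd a) (hd b) (zip (tl a) (tl b))"

text \<open>The elements of \<open>{\<top>, \<bottom>}\<close> are represented by \<^typ>\<open>bool\<close>, and \<open>tf\<close> turns them into formulas.\<close>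

definition CTop :: "'p ml" where
  "CTop = CNeg CBot"

definition tf :: "bool \<Rightarrow> 'p ml" where
  "tf x = (if x then CTop else CBot)"

definition sgn1 :: "'p ml \<Rightarrow> bool \<Rightarrow> 'p ml" where
  "sgn1 \<alpha> x = (if x then \<alpha> else CNeg \<alpha>)"

text \<open>Iterated conjunctions and disjunctions associate to the left.\<close>

fun foldl1 :: "('a \<Rightarrow> 'a \<Rightarrow> 'a) \<Rightarrow> 'a list \<Rightarrow> 'a" where
  "foldl1 f (x # xs) = foldl f x xs"

text \<open>\<open>sgns a x\<close> is \<open>a\<^sup>x\<close>, for nonempty \<open>a\<close> and \<open>x\<close> of the same length.\<close>

definition sgns :: "'p ml list \<Rightarrow> bool list \<Rightarrow> 'p ml" where
  "sgns a xs = foldl1 CAnd (map2 sgn1 a xs)"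

definition prim :: "bool list \<Rightarrow> 'p ml list \<Rightarrow> 'p mli" where
  "prim xs a = incl (map tf xs) a"

definition matched :: "'a list \<Rightarrow> 'b list \<Rightarrow> bool" where
  "matched a b \<longleftrightarrow> a \<noteq> [] \<and> length a = length b"


section \<open>Team semantics\<close>

record ('w, 'p) model =
  worlds :: "'w set"
  rel :: "('w \<times> 'w) set"
  val :: "'p \<Rightarrow> 'w set"

definition kripke :: "('w, 'p) model \<Rightarrow> bool" where
  "kripke M \<longleftrightarrow> rel M \<subseteq> worlds M \<times> worlds M \<and> (\<forall>p. val M p \<subseteq> worlds M)"

definition succ_team :: "('w \<times> 'w) set \<Rightarrow> 'w set \<Rightarrow> 'w set \<Rightarrow> bool" where
  "succ_team R T S \<longleftrightarrow> S \<subseteq> R `` T \<and> T \<subseteq> R\<inverse> `` S"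

primrec csat :: "('w, 'p) model \<Rightarrow> 'w set \<Rightarrow> 'p ml \<Rightarrow> bool" where
  "csat M T (CProp p) \<longleftrightarrow> T \<subseteq> val M p"
| "csat M T CBot \<longleftrightarrow> T = {}"
| "csat M T (CNeg \<alpha>) \<longleftrightarrow> (\<forall>w\<in>T. \<not> csat M {w} \<alpha>)"
| "csat M T (COr \<alpha> \<beta>) \<longleftrightarrow> (\<exists>T1 T2. T = T1 \<union> T2 \<and> csat M T1 \<alpha> \<and> csat M T2 \<beta>)"
| "csat M T (CAnd \<alpha> \<beta>) \<longleftrightarrow> csat M T \<alpha> \<and> csat M T \<beta>"
| "csat M T (CDia \<alpha>) \<longleftrightarrow> (\<exists>S. succ_team (rel M) T S \<and> csat M S \<alpha>)"
| "csat M T (CBox \<alpha>) \<longleftrightarrow> csat M (rel M `` T) \<alpha>"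

primrec sat :: "('w, 'p) model \<Rightarrow> 'w set \<Rightarrow> 'p mli \<Rightarrow> bool" where
  "sat M T (Prop p) \<longleftrightarrow> T \<subseteq> val M p"
| "sat M T Bot \<longleftrightarrow> T = {}"
| "sat M T (Inc \<alpha> \<beta> ps) \<longleftrightarrow>
    (\<forall>w\<in>T. \<exists>v\<in>T. \<forall>(\<gamma>, \<delta>)\<in>set ((\<alpha>, \<beta>) # ps). csat M {w} \<gamma> \<longleftrightarrow> csat M {v} \<delta>)"
| "sat M T (Neg \<alpha>) \<longleftrightarrow> (\<forall>w\<in>T. \<not> csat M {w} \<alpha>)"
| "sat M T (Or \<phi> \<psi>) \<longleftrightarrow> (\<exists>T1 T2. T = T1 \<union> T2 \<and> sat M T1 \<phi> \<and> sat M T2 \<psi>)"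
| "sat M T (And \<phi> \<psi>) \<longleftrightarrow> sat M T \<phi> \<and> sat M T \<psi>"
| "sat M T (Dia \<phi>) \<longleftrightarrow> (\<exists>S. succ_team (rel M) T S \<and> sat M S \<phi>)"
| "sat M T (Box \<phi>) \<longleftrightarrow> sat M (rel M `` T) \<phi>"

lemma sat_cl: "sat M T (cl \<alpha>) \<longleftrightarrow> csat M T \<alpha>"
  by (induction \<alpha> arbitrary: T) auto

lemma sat_incl:
  assumes "matched a b"
  shows "sat M T (incl a b) \<longleftrightarrow>
    (\<forall>w\<in>T. \<exists>v\<in>T. \<forall>i<length a. csat M {w} (a ! i) \<longleftrightarrow> csat M {v} (b ! i))"
proof -
  obtain \<alpha> a' \<beta> b' where ab: "a = \<alpha> # a'" "b = \<beta> # b'"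
    using assms by (cases a; cases b) (auto simp: matched_def)
  have "(hd a, hd b) # zip (tl a) (tl b) = zip a b"
    by (simp add: ab)
  moreover have "(\<forall>(\<gamma>, \<delta>)\<in>set (zip a b). P \<gamma> \<delta>) \<longleftrightarrow> (\<forall>i<length a. P (a ! i) (b ! i))" for P
    using assms by (force simp only: matched_def set_zip)
  ultimately show ?thesis
    by (simp only: incl_def sat.simps)
qed

text \<open>
  HOL cannot quantify over all types of worlds inside a formula, so the type of worlds is a
  parameter. The worlds of a model may form any subset of that type.
\<close>

definition entails :: "'w itself \<Rightarrow> 'p mli set \<Rightarrow> 'p mli \<Rightarrow> bool" where
  "entails (_ :: 'w itself) \<Gamma> \<phi> \<longleftrightarrow>
    (\<forall>(M :: ('w, 'p) model) T. kripke M \<longrightarrow> T \<subseteq> worlds M \<longrightarrow> (\<forall>\<gamma>\<in>\<Gamma>. sat M T \<gamma>) \<longrightarrow> sat M T \<phi>)"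


section \<open>Natural deduction\<close>

text \<open>
  \<open>\<Delta>\<close> ranges over sets of classical formulas. In the two distribution rules the side
  premises \<open>x\<^sub>1 \<subseteq> a\<^sub>1, \<dots>, x\<^sub>n \<subseteq> a\<^sub>n\<close> are given by the list \<open>L\<close> of the pairs \<open>(x\<^sub>i, a\<^sub>i)\<close>.
\<close>

inductive derives :: "'p mli set \<Rightarrow> 'p mli \<Rightarrow> bool" (infix "\<turnstile>" 50) where
  Assm: "\<phi> \<in> \<Gamma> \<Longrightarrow> \<Gamma> \<turnstile> \<phi>"
| NegI: "cl ` \<Delta> \<subseteq> \<Gamma> \<Longrightarrow> cl ` \<Delta> \<union> {cl \<alpha>} \<turnstile> Bot \<Longrightarrow> \<Gamma> \<turnstile> Neg \<alpha>"
| RAA: "cl ` \<Delta> \<subseteq> \<Gamma> \<Longrightarrow> cl ` \<Delta> \<union> {Neg \<alpha>} \<turnstile> Bot \<Longrightarrow> \<Gamma> \<turnstile> cl \<alpha>"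
| NegE: "\<Gamma> \<turnstile> cl \<alpha> \<Longrightarrow> \<Gamma> \<turnstile> Neg \<alpha> \<Longrightarrow> \<Gamma> \<turnstile> \<phi>"
| OrI1: "\<Gamma> \<turnstile> \<phi> \<Longrightarrow> \<Gamma> \<turnstile> Or \<phi> \<psi>"
| OrI2: "\<Gamma> \<turnstile> \<psi> \<Longrightarrow> \<Gamma> \<turnstile> Or \<phi> \<psi>"
| OrE: "cl ` \<Delta> \<subseteq> \<Gamma> \<Longrightarrow> \<Gamma> \<turnstile> Or \<phi> \<psi> \<Longrightarrow> cl ` \<Delta> \<union> {\<phi>} \<turnstile> \<chi> \<Longrightarrow> cl ` \<Delta> \<union> {\<psi>} \<turnstile> \<chi> \<Longrightarrow> \<Gamma> \<turnstile> \<chi>"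
| AndI: "\<Gamma> \<turnstile> \<phi> \<Longrightarrow> \<Gamma> \<turnstile> \<psi> \<Longrightarrow> \<Gamma> \<turnstile> And \<phi> \<psi>"
| AndE1: "\<Gamma> \<turnstile> And \<phi> \<psi> \<Longrightarrow> \<Gamma> \<turnstile> \<phi>"
| AndE2: "\<Gamma> \<turnstile> And \<phi> \<psi> \<Longrightarrow> \<Gamma> \<turnstile> \<psi>"
| DiaBoxInter: "\<Gamma> \<turnstile> Neg (CBox \<alpha>) \<Longrightarrow> \<Gamma> \<turnstile> Dia (Neg \<alpha>)"
| BoxDiaInter: "\<Gamma> \<turnstile> Dia (Neg \<alpha>) \<Longrightarrow> \<Gamma> \<turnstile> Neg (CBox \<alpha>)"
| DiaOrDistr: "\<Gamma> \<turnstile> Dia (Or \<phi> \<psi>) \<Longrightarrow> \<Gamma> \<turnstile> Or (Dia \<phi>) (Dia \<psi>)"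
| BoxMon: "finite \<Phi> \<Longrightarrow> \<Phi> \<turnstile> \<psi> \<Longrightarrow> (\<And>\<phi>. \<phi> \<in> \<Phi> \<Longrightarrow> \<Gamma> \<turnstile> Box \<phi>) \<Longrightarrow> \<Gamma> \<turnstile> Box \<psi>"
| DiaMon: "{\<phi>} \<turnstile> \<psi> \<Longrightarrow> \<Gamma> \<turnstile> Dia \<phi> \<Longrightarrow> \<Gamma> \<turnstile> Dia \<psi>"

| IncId: "a \<noteq> [] \<Longrightarrow> \<Gamma> \<turnstile> incl a a"
| IncExp: "matched b c \<Longrightarrow> \<Gamma> \<turnstile> cl (sgn1 \<alpha> x) \<Longrightarrow> \<Gamma> \<turnstile> incl b c \<Longrightarrow> \<Gamma> \<turnstile> incl (tf x # b) (\<alpha> # c)"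
| IncNegE: "matched xs a \<Longrightarrow> \<Gamma> \<turnstile> Neg (sgns a xs) \<Longrightarrow> \<Gamma> \<turnstile> prim xs a \<Longrightarrow> \<Gamma> \<turnstile> \<phi>"
| OrIncE: "matched xs a \<Longrightarrow> \<Gamma> \<turnstile> Or (prim xs a) \<psi> \<Longrightarrow>
    \<Gamma> \<union> {prim xs a} \<turnstile> \<chi> \<Longrightarrow> \<Gamma> \<union> {\<psi>} \<turnstile> \<chi> \<Longrightarrow> \<Gamma> \<turnstile> \<chi>"
| IncExt: "matched a b \<Longrightarrow>
    \<Gamma> \<turnstile> foldl1 And (map (\<lambda>xs. Or (Neg (sgns a xs)) (prim xs b)) (List.n_lists (length a) [True, False])) \<Longrightarrow>
    \<Gamma> \<turnstile> incl a b"
| IncRdt: "matched a b \<Longrightarrow> matched xs a \<Longrightarrow> \<Gamma> \<turnstile> incl a b \<Longrightarrow> \<Gamma> \<turnstile> Or (Neg (sgns a xs)) (prim xs b)"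
| IncDistr: "(\<And>xs a. (xs, a) \<in> set L \<Longrightarrow> matched xs a) \<Longrightarrow>
    \<Gamma> \<turnstile> Or \<phi> \<psi> \<Longrightarrow> (\<And>xs a. (xs, a) \<in> set L \<Longrightarrow> \<Gamma> \<turnstile> prim xs a) \<Longrightarrow>
    \<Gamma> \<turnstile> Or (foldl And (foldl Or \<phi> (map (\<lambda>(xs, a). cl (sgns a xs)) L)) (map (\<lambda>(xs, a). prim xs a) L)) \<psi>"

| DiaIncDistr: "matched xs a \<Longrightarrow> \<Gamma> \<turnstile> Dia (prim xs a) \<Longrightarrow> \<Gamma> \<turnstile> incl [CTop] [CDia (sgns a xs)]"
| DiaBoxIncExc: "matched xs a \<Longrightarrow> \<Gamma> \<turnstile> incl [CTop] [CDia (sgns a xs)] \<Longrightarrow> \<Gamma> \<turnstile> Box (prim xs a)"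
| BoxDiaIncExc: "matched xs a \<Longrightarrow> \<Gamma> \<turnstile> incl [CTop] [CDia \<beta>] \<Longrightarrow> \<Gamma> \<turnstile> Box (prim xs a) \<Longrightarrow>
    \<Gamma> \<turnstile> incl [CTop] [CDia (sgns a xs)]"
| BoxOrIncE: "matched xs a \<Longrightarrow> \<Gamma> \<turnstile> Box (Or (prim xs a) \<psi>) \<Longrightarrow>
    \<Gamma> \<union> {incl [CTop] [CDia (sgns a xs)]} \<turnstile> \<chi> \<Longrightarrow> \<Gamma> \<union> {Box \<psi>} \<turnstile> \<chi> \<Longrightarrow> \<Gamma> \<turnstile> \<chi>"
| IncDiaDistr: "\<Gamma> \<turnstile> Dia \<phi> \<Longrightarrow> (\<And>x \<alpha>. (x, \<alpha>) \<in> set L \<Longrightarrow> \<Gamma> \<turnstile> incl [tf x] [CDia \<alpha>]) \<Longrightarrow>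
    \<Gamma> \<turnstile> Dia (foldl And (foldl Or \<phi> (map (\<lambda>(x, \<alpha>). cl (sgn1 \<alpha> x)) L)) (map (\<lambda>(x, \<alpha>). incl [tf x] [\<alpha>]) L))"

end

theory Submission
  imports Defs
begin

text \<open>
  The atom \<open>\<top> \<subseteq> \<alpha>\<close>, written \<open>occ \<alpha>\<close> below, says that \<open>\<alpha>\<close> occurs somewhere in the team (unless the
  team is empty). Reducing \<open>\<alpha> \<subseteq> \<alpha>\<close> gives \<open>\<not>\<alpha> \<or> \<top> \<subseteq> \<alpha>\<close>, and since the elimination rule for a
  disjunction with such an atom keeps arbitrary side assumptions, every derivation may split into
  the cases \<open>occ \<alpha>\<close> and \<open>\<not>\<alpha>\<close> (lemma \<open>occ_split\<close>). This is Boolean reasoning about which classical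
  formulas occur in the team, although the disjunction of the logic is not Boolean. It is what makes
  cut admissible, and what makes a Lindenbaum construction possible: an underivable
  \<open>\<Gamma> \<turnstile> \<psi>\<close> extends to an underivable \<open>\<Gamma>' \<turnstile> \<psi>\<close> where \<open>\<Gamma>'\<close> contains \<open>occ \<alpha>\<close> or \<open>\<not>\<alpha>\<close> for every classical \<open>\<alpha>\<close>.

  Such a \<open>\<Gamma>'\<close> prescribes exactly which classical formulas occur in a team, and the team is found among
  the worlds of the canonical model of classical modal logic: one maximal consistent set for each
  formula that has to occur. Closing these under countably many diamond witnesses gives a countable
  model, which fits into any infinite type of worlds (\<open>complete_theory_model\<close>).

  The remaining question is why this team satisfies \<open>\<Gamma>\<close> and violates \<open>\<psi>\<close>. Fix a finite set \<open>A\<close> of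
  classical formulas. The type of a world is the set of members of \<open>A\<close> that hold there, and the diagram of a
  team says of each type, by means of its characteristic formula, whether it occurs.
  If \<open>A\<close> is large enough for \<open>\<phi>\<close>, then the diagram of a team decides \<open>\<phi>\<close> in the calculus: it derives \<open>\<phi>\<close> when the team
  satisfies \<open>\<phi>\<close>, and together with \<open>\<phi>\<close> it derives \<open>\<bottom>\<close> when not. This is proved by induction on \<open>\<phi>\<close>
  (\<open>decided_incl\<close>, \<open>decided_Or\<close>, \<open>decided_Dia\<close>, \<open>decided_Box\<close>); the negative half for disjunction and
  diamond rests on closure of satisfaction under unions, which gives each team a largest satisfying
  subteam and hence a world outside it whose type can be refuted. All derivations between classical
  formulas that this needs are obtained from completeness of classical modal logic, so that they
  become checks in Kripke models. As \<open>\<Gamma>'\<close> contains every diagram of its team, the theorem follows.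
\<close>

section \<open>Monotonicity, finiteness and cut\<close>

lemma derives_mono: "\<Gamma> \<turnstile> \<phi> \<Longrightarrow> \<Gamma> \<subseteq> \<Gamma>' \<Longrightarrow> \<Gamma>' \<turnstile> \<phi>"
proof (induction arbitrary: \<Gamma>' rule: derives.induct)
  case (NegI \<Delta> \<Gamma> \<alpha>) then show ?case by (meson derives.NegI subset_trans)
next
  case (RAA \<Delta> \<Gamma> \<alpha>) then show ?case by (meson derives.RAA subset_trans)
next
  case (OrE \<Delta> \<Gamma> \<phi> \<psi> \<chi>) then show ?case by (meson derives.OrE subset_trans)
next
  case (OrIncE xs a \<Gamma> \<psi> \<chi>) then show ?case
    by (meson derives.OrIncE Un_mono order_refl)
next
  case (BoxOrIncE xs a \<Gamma> \<psi> \<chi>) then show ?case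
    by (meson derives.BoxOrIncE Un_mono order_refl)
next
  case (IncDistr L \<Gamma> \<phi> \<psi>)
  show ?case by (rule derives.IncDistr) (use IncDistr in auto)
next
  case (IncDiaDistr \<Gamma> \<phi> L)
  show ?case by (rule derives.IncDiaDistr) (use IncDiaDistr in auto)
next
  case (DiaMon \<phi> \<psi> \<Gamma>) then show ?case by (blast intro: derives.DiaMon[OF DiaMon(1)])
next
  case (BoxDiaIncExc xs a \<Gamma> \<beta>)
  show ?case by (rule derives.BoxDiaIncExc[OF BoxDiaIncExc(1), of _ \<beta>]) (use BoxDiaIncExc in auto)
qed (auto intro: derives.intros)

text \<open>Serves the rules with several premises, in particular those whose number of premises varies.\<close>
lemma finite_family_support:
  assumes "finite I" and "\<And>i. i \<in> I \<Longrightarrow> \<exists>\<Gamma>0\<subseteq>\<Gamma>. finite \<Gamma>0 \<and> \<Gamma>0 \<turnstile> f i"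
  shows "\<exists>\<Gamma>0\<subseteq>\<Gamma>. finite \<Gamma>0 \<and> (\<forall>i\<in>I. \<Gamma>0 \<turnstile> f i)"
proof -
  obtain g where g: "\<And>i. i \<in> I \<Longrightarrow> g i \<subseteq> \<Gamma> \<and> finite (g i) \<and> g i \<turnstile> f i"
    using assms(2) by metis
  show ?thesis
  proof (intro exI conjI ballI)
    show "(\<Union>i\<in>I. g i) \<subseteq> \<Gamma>" "finite (\<Union>i\<in>I. g i)" using g assms(1) by auto
    fix i assume "i \<in> I" then show "(\<Union>i\<in>I. g i) \<turnstile> f i"
      using g by (meson UN_upper derives_mono)
  qed
qed

lemma common_support:
  assumes "\<exists>\<Gamma>0\<subseteq>\<Gamma>. finite \<Gamma>0 \<and> \<Gamma>0 \<turnstile> \<phi>" "\<exists>\<Gamma>0\<subseteq>\<Gamma>. finite \<Gamma>0 \<and> \<Gamma>0 \<turnstile> \<psi>"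
  shows "\<exists>\<Gamma>0\<subseteq>\<Gamma>. finite \<Gamma>0 \<and> \<Gamma>0 \<turnstile> \<phi> \<and> \<Gamma>0 \<turnstile> \<psi>"
  using finite_family_support[of "{\<phi>, \<psi>}" \<Gamma> "\<lambda>\<phi>. \<phi>"] assms by auto

lemma support_discharge:
  assumes "\<exists>\<Gamma>0\<subseteq>\<Gamma> \<union> {\<phi>}. finite \<Gamma>0 \<and> \<Gamma>0 \<turnstile> \<chi>"
  shows "\<exists>\<Gamma>0\<subseteq>\<Gamma>. finite \<Gamma>0 \<and> \<Gamma>0 \<union> {\<phi>} \<turnstile> \<chi>"
proof -
  obtain \<Gamma>0 where 0: "\<Gamma>0 \<subseteq> \<Gamma> \<union> {\<phi>}" "finite \<Gamma>0" "\<Gamma>0 \<turnstile> \<chi>" using assms by auto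
  show ?thesis
    by (rule exI[of _ "\<Gamma>0 - {\<phi>}"]) (use 0 in \<open>auto elim!: derives_mono\<close>)
qed

lemma classical_subset_image: "F \<subseteq> cl ` \<Delta> \<Longrightarrow> \<exists>\<Delta>0\<subseteq>\<Delta>. F = cl ` \<Delta>0"
  by (meson subset_imageE)

text \<open>
  A rule that discharges assumptions applies only over classical side assumptions. A finite subset
  of these is again an image under \<open>cl\<close>, so the restriction survives the passage to a finite support.
\<close>
lemma derives_finite: "\<Gamma> \<turnstile> \<phi> \<Longrightarrow> \<exists>\<Gamma>0\<subseteq>\<Gamma>. finite \<Gamma>0 \<and> \<Gamma>0 \<turnstile> \<phi>"
proof (induction rule: derives.induct)
  case (Assm \<phi> \<Gamma>) then show ?case by (intro exI[of _ "{\<phi>}"]) (auto intro: derives.Assm)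
next
  case (NegI \<Delta> \<Gamma> \<alpha>)
  obtain F where F: "F \<subseteq> cl ` \<Delta>" "finite F" "F \<union> {cl \<alpha>} \<turnstile> Bot" using support_discharge[OF NegI(3)] by blast
  obtain \<Delta>0 where "F = cl ` \<Delta>0" using classical_subset_image[OF F(1)] by blast
  then show ?case using F NegI(1) by (intro exI[of _ F]) (auto intro!: derives.NegI[of \<Delta>0])
next
  case (RAA \<Delta> \<Gamma> \<alpha>)
  obtain F where F: "F \<subseteq> cl ` \<Delta>" "finite F" "F \<union> {Neg \<alpha>} \<turnstile> Bot" using support_discharge[OF RAA(3)] by blast
  obtain \<Delta>0 where "F = cl ` \<Delta>0" using classical_subset_image[OF F(1)] by blast
  then show ?case using F RAA(1) by (intro exI[of _ F]) (auto intro!: derives.RAA[of \<Delta>0])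
next
  case (OrE \<Delta> \<Gamma> \<phi> \<psi> \<chi>)
  obtain F1 where F1: "F1 \<subseteq> cl ` \<Delta>" "finite F1" "F1 \<union> {\<phi>} \<turnstile> \<chi>" using support_discharge[OF OrE(6)] by blast
  obtain F2 where F2: "F2 \<subseteq> cl ` \<Delta>" "finite F2" "F2 \<union> {\<psi>} \<turnstile> \<chi>" using support_discharge[OF OrE(7)] by blast
  obtain G where G: "G \<subseteq> \<Gamma>" "finite G" "G \<turnstile> Or \<phi> \<psi>" using OrE by blast
  obtain \<Delta>0 where D: "F1 \<union> F2 = cl ` \<Delta>0" using classical_subset_image[OF Un_least[OF F1(1) F2(1)]] by blast
  show ?case
  proof (intro exI[of _ "G \<union> (F1 \<union> F2)"] conjI)
    show "G \<union> (F1 \<union> F2) \<turnstile> \<chi>" unfolding D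
    proof (rule derives.OrE[of \<Delta>0])
      show "G \<union> cl ` \<Delta>0 \<turnstile> Or \<phi> \<psi>" using G by (auto elim: derives_mono)
      show "cl ` \<Delta>0 \<union> {\<phi>} \<turnstile> \<chi>" by (rule derives_mono[OF F1(3)]) (use D in auto)
      show "cl ` \<Delta>0 \<union> {\<psi>} \<turnstile> \<chi>" by (rule derives_mono[OF F2(3)]) (use D in auto)
    qed auto
  qed (use F1 F2 G OrE(1) in auto)
next
  case (OrIncE xs a \<Gamma> \<psi> \<chi>)
  obtain G1 where 1: "G1 \<subseteq> \<Gamma>" "finite G1" "G1 \<turnstile> Or (prim xs a) \<psi>" using OrIncE by blast
  obtain G2 where 2: "G2 \<subseteq> \<Gamma>" "finite G2" "G2 \<union> {prim xs a} \<turnstile> \<chi>"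
    using support_discharge[OF OrIncE(6)] by blast
  obtain G3 where 3: "G3 \<subseteq> \<Gamma>" "finite G3" "G3 \<union> {\<psi>} \<turnstile> \<chi>"
    using support_discharge[OF OrIncE(7)] by blast
  have "G1 \<union> G2 \<union> G3 \<turnstile> \<chi>"
    by (rule derives.OrIncE[OF OrIncE(1)];
        (rule derives_mono[OF 1(3)] derives_mono[OF 2(3)] derives_mono[OF 3(3)]), blast)
  then show ?case using 1 2 3 by (intro exI[of _ "G1 \<union> G2 \<union> G3"]) simp
next
  case (BoxOrIncE xs a \<Gamma> \<psi> \<chi>)
  obtain G1 where 1: "G1 \<subseteq> \<Gamma>" "finite G1" "G1 \<turnstile> Box (Or (prim xs a) \<psi>)" using BoxOrIncE by blast
  obtain G2 where 2: "G2 \<subseteq> \<Gamma>" "finite G2" "G2 \<union> {incl [CTop] [CDia (sgns a xs)]} \<turnstile> \<chi>"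
    using support_discharge[OF BoxOrIncE(6)] by blast
  obtain G3 where 3: "G3 \<subseteq> \<Gamma>" "finite G3" "G3 \<union> {Box \<psi>} \<turnstile> \<chi>"
    using support_discharge[OF BoxOrIncE(7)] by blast
  have "G1 \<union> G2 \<union> G3 \<turnstile> \<chi>"
    by (rule derives.BoxOrIncE[OF BoxOrIncE(1)];
        (rule derives_mono[OF 1(3)] derives_mono[OF 2(3)] derives_mono[OF 3(3)]), blast)
  then show ?case using 1 2 3 by (intro exI[of _ "G1 \<union> G2 \<union> G3"]) simp
next
  case (IncDistr L \<Gamma> \<phi> \<psi>)
  have "\<exists>\<Gamma>0\<subseteq>\<Gamma>. finite \<Gamma>0 \<and> (\<forall>i\<in>set L. \<Gamma>0 \<turnstile> (\<lambda>(xs, a). prim xs a) i)"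
    by (rule finite_family_support, simp, clarsimp, rule IncDistr(5))
  then obtain G2 where 2: "G2 \<subseteq> \<Gamma>" "finite G2" "\<forall>i\<in>set L. G2 \<turnstile> (\<lambda>(xs, a). prim xs a) i" by blast
  then have 3: "G2 \<turnstile> prim xs a" if "(xs, a) \<in> set L" for xs a using that by auto
  obtain G1 where 1: "G1 \<subseteq> \<Gamma>" "finite G1" "G1 \<turnstile> Or \<phi> \<psi>" using IncDistr by blast
  have "G1 \<union> G2 \<turnstile> Or (foldl And (foldl Or \<phi> (map (\<lambda>(xs, a). cl (sgns a xs)) L)) (map (\<lambda>(xs, a). prim xs a) L)) \<psi>"
    by (intro derives.IncDistr IncDistr(1) derives_mono[OF 1(3)] derives_mono[OF 3]) auto
  then show ?case using 1 2 by (intro exI[of _ "G1 \<union> G2"]) simp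
next
  case (IncDiaDistr \<Gamma> \<phi> L)
  have "\<exists>\<Gamma>0\<subseteq>\<Gamma>. finite \<Gamma>0 \<and> (\<forall>i\<in>set L. \<Gamma>0 \<turnstile> (\<lambda>(x, \<alpha>). incl [tf x] [CDia \<alpha>]) i)"
    by (rule finite_family_support, simp, clarsimp, rule IncDiaDistr(4))
  then obtain G2 where 2: "G2 \<subseteq> \<Gamma>" "finite G2" "\<forall>i\<in>set L. G2 \<turnstile> (\<lambda>(x, \<alpha>). incl [tf x] [CDia \<alpha>]) i" by blast
  then have 3: "G2 \<turnstile> incl [tf x] [CDia \<alpha>]" if "(x, \<alpha>) \<in> set L" for x \<alpha> using that by auto
  obtain G1 where 1: "G1 \<subseteq> \<Gamma>" "finite G1" "G1 \<turnstile> Dia \<phi>" using IncDiaDistr by blast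
  have "G1 \<union> G2 \<turnstile> Dia (foldl And (foldl Or \<phi> (map (\<lambda>(x, \<alpha>). cl (sgn1 \<alpha> x)) L)) (map (\<lambda>(x, \<alpha>). incl [tf x] [\<alpha>]) L))"
    by (intro derives.IncDiaDistr derives_mono[OF 1(3)] derives_mono[OF 3]) auto
  then show ?case using 1 2 by (intro exI[of _ "G1 \<union> G2"]) simp
next
  case (NegE \<Gamma> \<alpha> \<phi>)
  obtain G where G: "G \<subseteq> \<Gamma>" "finite G" "G \<turnstile> cl \<alpha>" "G \<turnstile> Neg \<alpha>"
    using common_support[OF NegE(3) NegE(4)] by blast
  show ?case using G(1,2) derives.NegE[OF G(3,4)] by blast
next
  case (AndI \<Gamma> \<phi> \<psi>)
  obtain G where G: "G \<subseteq> \<Gamma>" "finite G" "G \<turnstile> \<phi>" "G \<turnstile> \<psi>"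
    using common_support[OF AndI(3) AndI(4)] by blast
  show ?case using G(1,2) derives.AndI[OF G(3,4)] by blast
next
  case (IncExp b c \<Gamma> \<alpha> x)
  obtain G where G: "G \<subseteq> \<Gamma>" "finite G" "G \<turnstile> cl (sgn1 \<alpha> x)" "G \<turnstile> incl b c"
    using common_support[OF IncExp(4) IncExp(5)] by blast
  show ?case using G(1,2) derives.IncExp[OF IncExp(1) G(3,4)] by blast
next
  case (IncNegE xs a \<Gamma> \<phi>)
  obtain G where G: "G \<subseteq> \<Gamma>" "finite G" "G \<turnstile> Neg (sgns a xs)" "G \<turnstile> prim xs a"
    using common_support[OF IncNegE(4) IncNegE(5)] by blast
  show ?case using G(1,2) derives.IncNegE[OF IncNegE(1) G(3,4)] by blast
next
  case (BoxDiaIncExc xs a \<Gamma> \<beta>)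
  obtain G where G: "G \<subseteq> \<Gamma>" "finite G" "G \<turnstile> incl [CTop] [CDia \<beta>]" "G \<turnstile> Box (prim xs a)"
    using common_support[OF BoxDiaIncExc(4) BoxDiaIncExc(5)] by blast
  show ?case using G(1,2) derives.BoxDiaIncExc[OF BoxDiaIncExc(1) G(3,4)] by blast
next
  case (BoxMon \<Phi> \<psi> \<Gamma>)
  obtain G where "G \<subseteq> \<Gamma>" "finite G" "\<forall>\<phi>\<in>\<Phi>. G \<turnstile> Box \<phi>"
    using finite_family_support[of \<Phi> \<Gamma> Box, OF BoxMon(1) BoxMon(5)] by blast
  then show ?case using derives.BoxMon[OF BoxMon(1,2), of G] by blast
next
  case (DiaMon \<phi> \<psi> \<Gamma>) then show ?case by (blast intro: derives.DiaMon[OF DiaMon(1)])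
next
  case (IncId a \<Gamma>) then show ?case by (blast intro: derives.IncId)
next
  case (IncRdt a b xs \<Gamma>) then show ?case by (blast intro: derives.IncRdt)
next
  case (IncExt a b \<Gamma>) then show ?case by (blast intro: derives.IncExt)
next
  case (DiaIncDistr xs a \<Gamma>) then show ?case by (blast intro: derives.DiaIncDistr)
next
  case (DiaBoxIncExc xs a \<Gamma>) then show ?case by (blast intro: derives.DiaBoxIncExc)
qed (meson derives.OrI1, meson derives.OrI2, meson derives.AndE1, meson derives.AndE2,
     meson derives.DiaBoxInter, meson derives.BoxDiaInter, meson derives.DiaOrDistr)

text \<open>The atom \<open>\<top> \<subseteq> \<alpha>\<close>: a nonempty team satisfies it iff \<open>\<alpha>\<close> holds at one of its worlds.\<close>
abbreviation occ :: "'p ml \<Rightarrow> 'p mli" where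
  "occ \<alpha> \<equiv> incl [CTop] [\<alpha>]"

lemma prim_top [simp]: "prim [True] [\<alpha>] = occ \<alpha>"
  by (simp add: prim_def tf_def)

lemma sgns_single [simp]: "sgns [\<alpha>] [True] = \<alpha>"
  by (simp add: sgns_def sgn1_def)

lemma matched_single [simp]: "matched [x] [y]"
  by (simp add: matched_def)

lemma derives_Bot: "\<Gamma> \<turnstile> Bot \<Longrightarrow> \<Gamma> \<turnstile> \<phi>"
  using derives.NegE[of \<Gamma> CBot \<phi>] derives.NegI[of "{}" \<Gamma> CBot] derives.Assm by fastforce

lemma occ_Neg_contra: "\<Gamma> \<turnstile> occ \<alpha> \<Longrightarrow> \<Gamma> \<turnstile> Neg \<alpha> \<Longrightarrow> \<Gamma> \<turnstile> \<chi>"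
  using derives.IncNegE[of "[True]" "[\<alpha>]"] by simp

text \<open>
  Reduction of \<open>a \<subseteq> a\<close> yields the disjunction of \<open>\<not>a\<^sup>x\<close> and \<open>x \<subseteq> a\<close> from nothing. Eliminating it does
  not restrict \<open>\<Gamma>\<close>, in contrast to the general elimination rule for disjunctions.
\<close>
lemma prim_split:
  assumes "matched xs a" "insert (prim xs a) \<Gamma> \<turnstile> \<chi>" "insert (Neg (sgns a xs)) \<Gamma> \<turnstile> \<chi>"
  shows "\<Gamma> \<turnstile> \<chi>"
proof -
  have m: "matched a a" "a \<noteq> []" using assms(1) by (auto simp: matched_def)
  have 1: "{} \<turnstile> Or (Neg (sgns a xs)) (prim xs a)"
    by (rule derives.IncRdt[OF m(1) assms(1) derives.IncId[OF m(2)]])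
  have "{} \<turnstile> Or (prim xs a) (Neg (sgns a xs))"
    by (rule derives.OrE[OF _ 1, of "{}"]) (auto intro: derives.OrI1 derives.OrI2 derives.Assm)
  then show ?thesis using assms by (auto intro: derives.OrIncE derives_mono)
qed

lemma occ_split: "insert (occ \<alpha>) \<Gamma> \<turnstile> \<chi> \<Longrightarrow> insert (Neg \<alpha>) \<Gamma> \<turnstile> \<chi> \<Longrightarrow> \<Gamma> \<turnstile> \<chi>"
  using prim_split[of "[True]" "[\<alpha>]"] by simp

text \<open>Weaken \<open>\<phi>\<close> to \<open>\<phi> \<or> \<bottom>\<close> and eliminate this disjunction without side assumptions.\<close>
lemma cut_single: "\<Gamma> \<turnstile> \<phi> \<Longrightarrow> {\<phi>} \<turnstile> \<chi> \<Longrightarrow> \<Gamma> \<turnstile> \<chi>"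
  by (rule derives.OrE[of "{}" _ \<phi> Bot]) (auto intro: derives.OrI1 derives_Bot derives.Assm)

lemma double_neg_intro: "{cl \<delta>} \<turnstile> Neg (CNeg \<delta>)"
proof -
  have "{cl \<delta>, Neg \<delta>} \<turnstile> Bot"
    by (rule derives.NegE[of _ \<delta>]) (auto intro: derives.Assm)
  then show ?thesis
    by (intro derives.NegI[of "{\<delta>}"]) (auto simp: insert_commute)
qed

lemma double_neg_elim: "{Neg (CNeg \<delta>)} \<turnstile> cl \<delta>"
proof -
  have "{Neg (CNeg \<delta>), Neg \<delta>} \<turnstile> Bot"
    by (rule derives.NegE[of _ "CNeg \<delta>"]) (auto intro: derives.Assm)
  then show ?thesis
    by (intro derives.RAA[of "{CNeg (CNeg \<delta>)}"]) (auto simp: insert_commute)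
qed

text \<open>
  A derived \<open>\<delta>\<close> is not an assumption, so the rules that demand classical assumptions cannot use it.
  Splitting on \<open>\<not>\<delta>\<close> turns it into one: the case \<open>occ (\<not>\<delta>)\<close> contradicts \<open>\<delta>\<close>, and in the other
  case \<open>\<delta>\<close> itself is available as an assumption.
\<close>
lemma cut_classical_single:
  assumes "\<Gamma> \<turnstile> cl \<delta>" "insert (cl \<delta>) \<Gamma> \<turnstile> \<chi>"
  shows "\<Gamma> \<turnstile> \<chi>"
proof -
  have or: "\<Gamma> \<turnstile> Or (prim [True] [CNeg \<delta>]) (cl \<delta>)"
    by (rule occ_split[of "CNeg \<delta>"])
       (auto intro: derives.OrI1 derives.OrI2 derives.Assm cut_single[OF _ double_neg_elim])
  have "insert (occ (CNeg \<delta>)) \<Gamma> \<turnstile> \<chi>"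
    by (rule occ_Neg_contra[of _ "CNeg \<delta>"])
       (auto intro: derives.Assm cut_single[OF derives_mono[OF assms(1)] double_neg_intro])
  then show ?thesis
    by (intro derives.OrIncE[OF _ or]) (use assms(2) in auto)
qed

lemma cut_classical:
  assumes "\<And>\<delta>. \<delta> \<in> \<Delta> \<Longrightarrow> \<Gamma> \<turnstile> cl \<delta>" "\<Gamma> \<union> cl ` \<Delta> \<turnstile> \<chi>"
  shows "\<Gamma> \<turnstile> \<chi>"
proof -
  obtain F where F: "F \<subseteq> \<Gamma> \<union> cl ` \<Delta>" "finite F" "F \<turnstile> \<chi>" using derives_finite[OF assms(2)] by blast
  have gen: "G \<subseteq> cl ` \<Delta> \<longrightarrow> \<Gamma> \<union> G \<turnstile> \<chi> \<longrightarrow> \<Gamma> \<turnstile> \<chi>" if "finite G" for G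
    using that
  proof (induction G)
    case (insert g G)
    show ?case
    proof (intro impI)
      assume sub: "insert g G \<subseteq> cl ` \<Delta>" and der: "\<Gamma> \<union> insert g G \<turnstile> \<chi>"
      obtain \<delta> where d: "\<delta> \<in> \<Delta>" "g = cl \<delta>" using sub by blast
      have "\<Gamma> \<union> G \<turnstile> \<chi>"
        by (rule cut_classical_single[OF derives_mono[OF assms(1)[OF d(1)]]]) (use der d in auto)
      then show "\<Gamma> \<turnstile> \<chi>" using insert.IH sub by simp
    qed
  qed simp
  show ?thesis
    by (rule gen[of "F \<inter> cl ` \<Delta>", rule_format], use F(2) in simp, simp,
        rule derives_mono[OF F(3)], use F(1) in blast)
qed

text \<open>
  The derivation of \<open>\<chi>\<close> may discharge over a classical part \<open>\<Delta>\<close> of \<open>\<Sigma>\<close> that \<open>\<Gamma>\<close> derives but does not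
  contain. There \<open>\<Delta>\<close> is first added to \<open>\<Gamma>\<close> and then removed by \<open>cut_classical\<close>.
\<close>
lemma cut: "\<Sigma> \<turnstile> \<chi> \<Longrightarrow> (\<And>\<sigma>. \<sigma> \<in> \<Sigma> \<Longrightarrow> \<Gamma> \<turnstile> \<sigma>) \<Longrightarrow> \<Gamma> \<turnstile> \<chi>"
proof (induction arbitrary: \<Gamma> rule: derives.induct)
  case (NegI \<Delta> \<Sigma> \<alpha>)
  show ?case
    by (rule cut_classical[of \<Delta>]) (use NegI(1,2,4) in \<open>auto intro: derives.NegI[of \<Delta>]\<close>)
next
  case (RAA \<Delta> \<Sigma> \<alpha>)
  show ?case
    by (rule cut_classical[of \<Delta>]) (use RAA(1,2,4) in \<open>auto intro: derives.RAA[of \<Delta>]\<close>)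
next
  case (OrE \<Delta> \<Sigma> \<phi> \<psi> \<chi>)
  show ?case
  proof (rule cut_classical[of \<Delta>])
    show "\<Gamma> \<union> cl ` \<Delta> \<turnstile> \<chi>"
      by (rule derives.OrE[OF _ derives_mono[OF OrE(5)[OF OrE(8)]] OrE(3,4)]) auto
  qed (use OrE(1,8) in auto)
next
  case (OrIncE xs a \<Sigma> \<psi> \<chi>)
  show ?case
  proof (rule derives.OrIncE[OF OrIncE(1) OrIncE(5)[OF OrIncE(8)]])
    show "\<Gamma> \<union> {prim xs a} \<turnstile> \<chi>"
      by (rule OrIncE(6)) (auto intro: derives.Assm derives_mono[OF OrIncE(8)])
    show "\<Gamma> \<union> {\<psi>} \<turnstile> \<chi>"
      by (rule OrIncE(7)) (auto intro: derives.Assm derives_mono[OF OrIncE(8)])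
  qed
next
  case (BoxOrIncE xs a \<Sigma> \<psi> \<chi>)
  show ?case
  proof (rule derives.BoxOrIncE[OF BoxOrIncE(1) BoxOrIncE(5)[OF BoxOrIncE(8)]])
    show "\<Gamma> \<union> {incl [CTop] [CDia (sgns a xs)]} \<turnstile> \<chi>"
      by (rule BoxOrIncE(6)) (auto intro: derives.Assm derives_mono[OF BoxOrIncE(8)])
    show "\<Gamma> \<union> {Box \<psi>} \<turnstile> \<chi>"
      by (rule BoxOrIncE(7)) (auto intro: derives.Assm derives_mono[OF BoxOrIncE(8)])
  qed
next
  case (IncDistr L \<Gamma> \<phi> \<psi>)
  show ?case by (rule derives.IncDistr) (use IncDistr in auto)
next
  case (IncDiaDistr \<Gamma> \<phi> L)
  show ?case by (rule derives.IncDiaDistr) (use IncDiaDistr in auto)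
next
  case (DiaMon \<phi> \<psi> \<Gamma>) then show ?case by (blast intro: derives.DiaMon[OF DiaMon(1)])
next
  case (BoxDiaIncExc xs a \<Gamma> \<beta>)
  show ?case by (rule derives.BoxDiaIncExc[OF BoxDiaIncExc(1), of _ \<beta>]) (use BoxDiaIncExc in auto)
qed (auto intro: derives.intros)

section \<open>Completeness of classical modal logic\<close>

primrec wsat :: "('w, 'p) model \<Rightarrow> 'w \<Rightarrow> 'p ml \<Rightarrow> bool" where
  "wsat M w (CProp p) \<longleftrightarrow> w \<in> val M p"
| "wsat M w CBot \<longleftrightarrow> False"
| "wsat M w (CNeg \<alpha>) \<longleftrightarrow> \<not> wsat M w \<alpha>"
| "wsat M w (COr \<alpha> \<beta>) \<longleftrightarrow> wsat M w \<alpha> \<or> wsat M w \<beta>"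
| "wsat M w (CAnd \<alpha> \<beta>) \<longleftrightarrow> wsat M w \<alpha> \<and> wsat M w \<beta>"
| "wsat M w (CDia \<alpha>) \<longleftrightarrow> (\<exists>v. (w, v) \<in> rel M \<and> wsat M v \<alpha>)"
| "wsat M w (CBox \<alpha>) \<longleftrightarrow> (\<forall>v. (w, v) \<in> rel M \<longrightarrow> wsat M v \<alpha>)"

lemma csat_flat: "csat M T \<alpha> \<longleftrightarrow> (\<forall>w\<in>T. wsat M w \<alpha>)"
proof (induction \<alpha> arbitrary: T)
  case (COr \<alpha> \<beta>)
  show ?case (is "_ \<longleftrightarrow> ?R")
  proof
    assume ?R
    then have "T = {w\<in>T. wsat M w \<alpha>} \<union> {w\<in>T. wsat M w \<beta>}" by auto
    then show "csat M T (COr \<alpha> \<beta>)" unfolding csat.simps COr by blast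
  qed (auto simp: COr)
next
  case (CDia \<alpha>)
  show ?case (is "_ \<longleftrightarrow> ?R")
  proof
    assume ?R
    then have "succ_team (rel M) T {v \<in> rel M `` T. wsat M v \<alpha>}"
      unfolding succ_team_def by fastforce
    then show "csat M T (CDia \<alpha>)" unfolding csat.simps CDia by blast
  qed (fastforce simp: CDia succ_team_def)
qed auto

text \<open>
  Stated along a map \<open>f\<close> so that it serves both for theories of all formulas and, with \<open>f = cl\<close>, for
  maximal consistent sets of classical formulas.
\<close>
lemma maximal_underivable:
  fixes f :: "'a \<Rightarrow> 'p mli"
  assumes "\<not> f ` A \<turnstile> \<psi>"
  obtains B where "A \<subseteq> B" "\<not> f ` B \<turnstile> \<psi>" "\<And>C. B \<subset> C \<Longrightarrow> f ` C \<turnstile> \<psi>"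
proof -
  let ?\<A> = "{B. A \<subseteq> B \<and> \<not> f ` B \<turnstile> \<psi>}"
  have "\<exists>B\<in>?\<A>. \<forall>X\<in>?\<A>. B \<subseteq> X \<longrightarrow> X = B"
  proof (rule subset_Zorn_nonempty)
    show "?\<A> \<noteq> {}" using assms by blast
    fix \<C> assume C: "\<C> \<noteq> {}" "subset.chain ?\<A> \<C>"
    have "\<not> f ` \<Union>\<C> \<turnstile> \<psi>"
    proof
      assume "f ` \<Union>\<C> \<turnstile> \<psi>"
      then obtain F where F: "F \<subseteq> f ` \<Union>\<C>" "finite F" "F \<turnstile> \<psi>" using derives_finite by blast
      then obtain F0 where F0: "F0 \<subseteq> \<Union>\<C>" "finite F0" "F = f ` F0"
        by (meson finite_subset_image)
      obtain B where "B \<in> \<C>" "F0 \<subseteq> B"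
        using finite_subset_Union_chain[OF F0(2,1) C] by blast
      then show False using C(2) F(3) F0(3) unfolding subset.chain_def
        by (metis (no_types, lifting) derives_mono image_mono mem_Collect_eq subset_iff)
    qed
    moreover have "A \<subseteq> \<Union>\<C>" using C unfolding subset.chain_def by blast
    ultimately show "\<Union>\<C> \<in> ?\<A>" by blast
  qed
  then show thesis using that by (smt (verit, best) dual_order.trans mem_Collect_eq psubset_eq)
qed

text \<open>Maximal consistent sets of classical formulas.\<close>
definition mcs :: "'p ml set \<Rightarrow> bool" where
  "mcs w \<longleftrightarrow> \<not> cl ` w \<turnstile> Bot \<and> (\<forall>w'. w \<subset> w' \<longrightarrow> cl ` w' \<turnstile> Bot)"

lemma lindenbaum: "\<not> cl ` \<Delta> \<turnstile> Bot \<Longrightarrow> \<exists>w. \<Delta> \<subseteq> w \<and> mcs w"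
  by (metis maximal_underivable mcs_def)

lemma mcs_insert: "mcs w \<Longrightarrow> \<alpha> \<notin> w \<Longrightarrow> cl ` w \<union> {cl \<alpha>} \<turnstile> Bot"
  unfolding mcs_def by (metis Un_insert_right boolean_algebra.disj_zero_right image_insert psubsetI subset_insertI insertI1)

lemma mcs_closed: "mcs w \<Longrightarrow> cl ` w \<turnstile> cl \<alpha> \<longleftrightarrow> \<alpha> \<in> w"
proof
  assume w: "mcs w" and d: "cl ` w \<turnstile> cl \<alpha>"
  show "\<alpha> \<in> w"
  proof (rule ccontr)
    assume "\<alpha> \<notin> w"
    then have "cl ` w \<turnstile> Bot" using cut_classical_single[OF d] mcs_insert[OF w] by simp
    then show False using w by (simp add: mcs_def)
  qed
qed (simp add: derives.Assm)

lemma mcs_Neg: assumes "mcs w" shows "CNeg \<alpha> \<in> w \<longleftrightarrow> \<alpha> \<notin> w"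
proof
  assume "CNeg \<alpha> \<in> w"
  then have "cl ` w \<turnstile> Neg \<alpha>" using mcs_closed[OF assms, of "CNeg \<alpha>"] by simp
  then show "\<alpha> \<notin> w"
    using derives.NegE mcs_closed[OF assms] assms unfolding mcs_def by metis
next
  assume "\<alpha> \<notin> w"
  then have "cl ` w \<turnstile> Neg \<alpha>" using derives.NegI[OF order_refl mcs_insert[OF assms]] by blast
  then show "CNeg \<alpha> \<in> w" using mcs_closed[OF assms, of "CNeg \<alpha>"] by simp
qed

lemma mcs_Or: assumes "mcs w" shows "COr \<alpha> \<beta> \<in> w \<longleftrightarrow> \<alpha> \<in> w \<or> \<beta> \<in> w"
proof
  assume "COr \<alpha> \<beta> \<in> w"
  then have d: "cl ` w \<turnstile> Or (cl \<alpha>) (cl \<beta>)" using mcs_closed[OF assms, of "COr \<alpha> \<beta>"] by simp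
  show "\<alpha> \<in> w \<or> \<beta> \<in> w"
  proof (rule ccontr)
    assume "\<not> (\<alpha> \<in> w \<or> \<beta> \<in> w)"
    then have "cl ` w \<turnstile> Bot" using derives.OrE[OF order_refl d] mcs_insert[OF assms] by blast
    then show False using assms by (simp add: mcs_def)
  qed
next
  assume "\<alpha> \<in> w \<or> \<beta> \<in> w"
  then have "cl ` w \<turnstile> Or (cl \<alpha>) (cl \<beta>)" using mcs_closed[OF assms] derives.OrI1 derives.OrI2 by metis
  then show "COr \<alpha> \<beta> \<in> w" using mcs_closed[OF assms, of "COr \<alpha> \<beta>"] by simp
qed

lemma mcs_And: assumes "mcs w" shows "CAnd \<alpha> \<beta> \<in> w \<longleftrightarrow> \<alpha> \<in> w \<and> \<beta> \<in> w"
proof -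
  have "cl ` w \<turnstile> And (cl \<alpha>) (cl \<beta>) \<longleftrightarrow> cl ` w \<turnstile> cl \<alpha> \<and> cl ` w \<turnstile> cl \<beta>"
    using derives.AndI derives.AndE1 derives.AndE2 by blast
  then show ?thesis using mcs_closed[OF assms] by (metis cl.simps(5))
qed

lemma mcs_Bot: "mcs w \<Longrightarrow> CBot \<notin> w"
  using mcs_closed[of w CBot] by (auto simp: mcs_def)

definition canon_rel :: "'p ml set \<Rightarrow> 'p ml set \<Rightarrow> bool" where
  "canon_rel w v \<longleftrightarrow> {\<beta>. CBox \<beta> \<in> w} \<subseteq> v"

text \<open>
  If the \<open>\<beta>\<close> with \<open>\<box>\<beta>\<close> in \<open>w\<close> refuted \<open>\<alpha>\<close>, then finitely many of them would, and monotonicity of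
  \<open>\<box>\<close> would put \<open>\<box>\<not>\<alpha>\<close> into \<open>w\<close>, against \<open>\<diamond>\<alpha>\<close>.
\<close>
lemma mcs_Dia_witness:
  assumes w: "mcs w" and dia: "CDia \<alpha> \<in> w"
  shows "\<exists>v. mcs v \<and> canon_rel w v \<and> \<alpha> \<in> v"
proof -
  let ?B = "{\<beta>. CBox \<beta> \<in> w}"
  have "\<not> cl ` insert \<alpha> ?B \<turnstile> Bot"
  proof
    assume "cl ` insert \<alpha> ?B \<turnstile> Bot"
    then have "cl ` ?B \<turnstile> Neg \<alpha>" by (intro derives.NegI[OF order_refl]) simp
    then obtain F where F: "F \<subseteq> cl ` ?B" "finite F" "F \<turnstile> Neg \<alpha>" using derives_finite by blast
    have "cl ` w \<turnstile> Box \<phi>" if phi: "\<phi> \<in> F" for \<phi>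
    proof -
      obtain \<beta> where "CBox \<beta> \<in> w" "\<phi> = cl \<beta>" using subsetD[OF F(1) phi] by blast
      then show ?thesis using mcs_closed[OF w, of "CBox \<beta>"] by simp
    qed
    then have 1: "cl ` w \<turnstile> cl (CBox (CNeg \<alpha>))" using derives.BoxMon[OF F(2,3)] by simp
    have "cl ` w \<turnstile> Dia (cl \<alpha>)" using dia mcs_closed[OF w, of "CDia \<alpha>"] by simp
    then have "cl ` w \<turnstile> Neg (CBox (CNeg \<alpha>))"
      using derives.DiaMon[OF double_neg_intro] derives.BoxDiaInter by blast
    then show False using derives.NegE[OF 1] w by (simp add: mcs_def)
  qed
  then show ?thesis unfolding canon_rel_def using lindenbaum by blast
qed

lemma mcs_Box_witness:
  assumes w: "mcs w" and box: "CBox \<alpha> \<notin> w"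
  shows "CDia (CNeg \<alpha>) \<in> w"
  using mcs_closed[OF w] mcs_Neg[OF w] box derives.DiaBoxInter[of "cl ` w" \<alpha>]
  by (metis cl.simps(3,6))

lemma mcs_Dia_pred:
  assumes w: "mcs w" and v: "mcs v" and r: "canon_rel w v" and a: "\<alpha> \<in> v"
  shows "CDia \<alpha> \<in> w"
proof -
  have "CNeg \<alpha> \<notin> v" using a mcs_Neg[OF v] by blast
  then have "CBox (CNeg \<alpha>) \<notin> w" using r by (auto simp: canon_rel_def)
  then have "cl ` w \<turnstile> cl (CDia (CNeg (CNeg \<alpha>)))" using mcs_Box_witness[OF w] mcs_closed[OF w] by blast
  then have "cl ` w \<turnstile> cl (CDia \<alpha>)" using derives.DiaMon[OF double_neg_elim] by simp
  then show ?thesis using mcs_closed[OF w] by blast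
qed

text \<open>
  The worlds are renamed by \<open>f\<close> and restricted to \<open>W\<close>, because the model that is needed in the end
  must be a countable part of the canonical model, carried over to another type of worlds.
\<close>
definition canon_model :: "('p ml set \<Rightarrow> 'w) \<Rightarrow> 'p ml set set \<Rightarrow> ('w, 'p) model" where
  "canon_model f W = \<lparr>worlds = f ` W,
     rel = {(f w, f v) |w v. w \<in> W \<and> v \<in> W \<and> canon_rel w v},
     val = (\<lambda>p. f ` {w \<in> W. CProp p \<in> w})\<rparr>"

lemma kripke_canon_model: "kripke (canon_model f W)"
  by (auto simp: kripke_def canon_model_def)

text \<open>All that the truth lemma requires of a set of worlds.\<close>
definition witnessed :: "'p ml set set \<Rightarrow> bool" where
  "witnessed W \<longleftrightarrow> (\<forall>w\<in>W. mcs w \<and> (\<forall>\<alpha>. CDia \<alpha> \<in> w \<longrightarrow> (\<exists>v\<in>W. canon_rel w v \<and> \<alpha> \<in> v)))"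

lemma truth_lemma:
  assumes wit: "witnessed W" and f: "inj_on f W" and "w \<in> W"
  shows "wsat (canon_model f W) (f w) \<alpha> \<longleftrightarrow> \<alpha> \<in> w"
proof -
  have W: "\<And>w. w \<in> W \<Longrightarrow> mcs w"
    and closed: "\<And>w \<alpha>. w \<in> W \<Longrightarrow> CDia \<alpha> \<in> w \<Longrightarrow> \<exists>v\<in>W. canon_rel w v \<and> \<alpha> \<in> v"
    using wit by (auto simp: witnessed_def)
  show ?thesis
    using assms(3)
  proof (induction \<alpha> arbitrary: w)
    case (CProp p) then show ?case using f by (auto simp: canon_model_def inj_on_def)
  next
    case (CDia \<alpha>)
    have "(f w, u) \<in> rel (canon_model f W) \<longleftrightarrow> (\<exists>v\<in>W. canon_rel w v \<and> u = f v)" for u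
      using f CDia.prems by (auto simp: canon_model_def inj_on_def)
    then have "wsat (canon_model f W) (f w) (CDia \<alpha>) \<longleftrightarrow> (\<exists>v\<in>W. canon_rel w v \<and> \<alpha> \<in> v)"
      using CDia.IH by auto
    then show ?case using closed[OF CDia.prems] mcs_Dia_pred[OF W[OF CDia.prems] W] by blast
  next
    case (CBox \<alpha>)
    have "(f w, u) \<in> rel (canon_model f W) \<longleftrightarrow> (\<exists>v\<in>W. canon_rel w v \<and> u = f v)" for u
      using f CBox.prems by (auto simp: canon_model_def inj_on_def)
    then have "wsat (canon_model f W) (f w) (CBox \<alpha>) \<longleftrightarrow> (\<forall>v\<in>W. canon_rel w v \<longrightarrow> \<alpha> \<in> v)"
      using CBox.IH by auto
    also have "\<dots> \<longleftrightarrow> CBox \<alpha> \<in> w"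
    proof
      assume all: "\<forall>v\<in>W. canon_rel w v \<longrightarrow> \<alpha> \<in> v"
      show "CBox \<alpha> \<in> w"
      proof (rule ccontr)
        assume "CBox \<alpha> \<notin> w"
        from closed[OF CBox.prems mcs_Box_witness[OF W[OF CBox.prems] this]]
        show False using all mcs_Neg W by blast
      qed
    qed (auto simp: canon_rel_def)
    finally show ?case .
  qed (use W in \<open>auto simp: mcs_Neg mcs_Or mcs_And mcs_Bot\<close>)
qed

text \<open>
  Turns derivability among classical formulas into a question about worlds of Kripke models. The type
  of worlds is the one that carries the full canonical model.
\<close>
lemma classical_completeness:
  fixes \<alpha> :: "'p ml"
  assumes "\<And>(M :: ('p ml set, 'p) model) w. (\<And>\<delta>. \<delta> \<in> \<Delta> \<Longrightarrow> wsat M w \<delta>) \<Longrightarrow> wsat M w \<alpha>"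
  shows "cl ` \<Delta> \<turnstile> cl \<alpha>"
proof (rule ccontr)
  assume "\<not> cl ` \<Delta> \<turnstile> cl \<alpha>"
  then have "\<not> cl ` insert (CNeg \<alpha>) \<Delta> \<turnstile> Bot"
    using derives.RAA[of \<Delta> "cl ` \<Delta>" \<alpha>] by auto
  then obtain w where w: "insert (CNeg \<alpha>) \<Delta> \<subseteq> w" "mcs w" using lindenbaum by blast
  have truth: "wsat (canon_model (\<lambda>v. v) (Collect mcs)) w \<beta> \<longleftrightarrow> \<beta> \<in> w" for \<beta>
    by (rule truth_lemma) (use w mcs_Dia_witness in \<open>auto simp: witnessed_def\<close>)
  have "\<alpha> \<in> w" using assms[of "canon_model (\<lambda>v. v) (Collect mcs)" w] truth w(1) by blast
  then show False using w mcs_Neg by blast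
qed

section \<open>Types of worlds and diagrams of teams\<close>

lemma derives_foldl_And: "\<Gamma> \<turnstile> foldl And \<phi> l \<longleftrightarrow> \<Gamma> \<turnstile> \<phi> \<and> (\<forall>\<psi>\<in>set l. \<Gamma> \<turnstile> \<psi>)"
proof (induction l arbitrary: \<phi>)
  case (Cons \<psi> l)
  have "\<Gamma> \<turnstile> And \<phi> \<psi> \<longleftrightarrow> \<Gamma> \<turnstile> \<phi> \<and> \<Gamma> \<turnstile> \<psi>"
    using derives.AndI derives.AndE1 derives.AndE2 by blast
  then show ?case using Cons by simp
qed simp

lemma foldl_Or_cl: "foldl Or (cl \<alpha>) (map (\<lambda>x. cl (g x)) l) = cl (foldl COr \<alpha> (map g l))"
  by (induction l arbitrary: \<alpha>) (simp_all flip: cl.simps)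

lemma wsat_foldl_COr: "wsat M w (foldl COr \<alpha> l) \<longleftrightarrow> wsat M w \<alpha> \<or> (\<exists>\<beta>\<in>set l. wsat M w \<beta>)"
  by (induction l arbitrary: \<alpha>) auto

lemma wsat_sgn1 [simp]: "wsat M w (sgn1 \<alpha> x) \<longleftrightarrow> wsat M w \<alpha> = x"
  by (auto simp: sgn1_def)

lemma wsat_sgns:
  assumes "matched xs a"
  shows "wsat M w (sgns a xs) \<longleftrightarrow> map (wsat M w) a = xs"
proof -
  have gen: "wsat M w (foldl CAnd \<gamma> (map2 sgn1 a xs)) \<longleftrightarrow> wsat M w \<gamma> \<and> map (wsat M w) a = xs"
    if "length a = length xs" for \<gamma> a xs
    using that by (induction a xs arbitrary: \<gamma> rule: list_induct2) auto
  show ?thesis using assms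
    by (cases a; cases xs) (auto simp: matched_def sgns_def gen)
qed

text \<open>
  Inclusions with constants on the left thus reduce to atoms \<open>occ\<close>. Either direction splits on the
  atom to be derived; in the remaining case \<open>\<not>a\<^sup>x\<close> contradicts the atom that is given.
\<close>
lemma prim_iff_occ:
  assumes "matched xs a"
  shows "\<Gamma> \<turnstile> prim xs a \<longleftrightarrow> \<Gamma> \<turnstile> occ (sgns a xs)"
proof
  assume d: "\<Gamma> \<turnstile> prim xs a"
  show "\<Gamma> \<turnstile> occ (sgns a xs)"
  proof (rule occ_split[of "sgns a xs"])
    show "insert (Neg (sgns a xs)) \<Gamma> \<turnstile> occ (sgns a xs)"
      by (rule derives.IncNegE[OF assms]) (auto intro: derives.Assm derives_mono[OF d])
  qed (auto intro: derives.Assm)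
next
  assume d: "\<Gamma> \<turnstile> occ (sgns a xs)"
  show "\<Gamma> \<turnstile> prim xs a"
  proof (rule prim_split[OF assms])
    show "insert (Neg (sgns a xs)) \<Gamma> \<turnstile> prim xs a"
      by (rule occ_Neg_contra[of _ "sgns a xs"]) (auto intro: derives.Assm derives_mono[OF d])
  qed (auto intro: derives.Assm)
qed

lemma classical_consequence:
  assumes "\<And>(M :: ('p ml set, 'p) model) w. wsat M w \<alpha> \<Longrightarrow> wsat M w \<beta>"
  shows "{cl \<alpha>} \<turnstile> cl \<beta>"
  using classical_completeness[of "{\<alpha>}" \<beta>] assms by auto

lemma occ_mono:
  assumes "\<Gamma> \<turnstile> occ \<alpha>" "\<And>(M :: ('p ml set, 'p) model) w. wsat M w \<alpha> \<Longrightarrow> wsat M w \<beta>"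
  shows "\<Gamma> \<turnstile> occ \<beta>"
proof (rule occ_split[of \<beta>])
  have "{cl (CNeg \<beta>)} \<turnstile> cl (CNeg \<alpha>)" by (rule classical_consequence) (use assms(2) in auto)
  then have "insert (Neg \<beta>) \<Gamma> \<turnstile> Neg \<alpha>" by (auto intro: derives_mono)
  then show "insert (Neg \<beta>) \<Gamma> \<turnstile> occ \<beta>"
    by (rule occ_Neg_contra[rotated]) (auto intro: derives_mono[OF assms(1)])
qed (auto intro: derives.Assm)

text \<open>The order of the conjuncts is irrelevant, so any enumeration of the finite set will do.\<close>
definition bigand :: "'p ml set \<Rightarrow> 'p ml" where
  "bigand A = foldr CAnd (SOME l. set l = A) CTop"

definition bigor :: "'p ml set \<Rightarrow> 'p ml" where
  "bigor A = foldr COr (SOME l. set l = A) CBot"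

lemma set_some_list: "finite A \<Longrightarrow> set (SOME l. set l = A) = A"
  using someI_ex[OF finite_list] .

lemma wsat_bigand: "finite A \<Longrightarrow> wsat M w (bigand A) \<longleftrightarrow> (\<forall>\<alpha>\<in>A. wsat M w \<alpha>)"
proof -
  have "wsat M w (foldr CAnd l CTop) \<longleftrightarrow> (\<forall>\<alpha>\<in>set l. wsat M w \<alpha>)" for l
    by (induction l) (auto simp: CTop_def)
  then show "finite A \<Longrightarrow> ?thesis" by (simp add: bigand_def set_some_list)
qed

lemma wsat_bigor: "finite A \<Longrightarrow> wsat M w (bigor A) \<longleftrightarrow> (\<exists>\<alpha>\<in>A. wsat M w \<alpha>)"
proof -
  have "wsat M w (foldr COr l CBot) \<longleftrightarrow> (\<exists>\<alpha>\<in>set l. wsat M w \<alpha>)" for l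
    by (induction l) auto
  then show "finite A \<Longrightarrow> ?thesis" by (simp add: bigor_def set_some_list)
qed

definition tp :: "'p ml set \<Rightarrow> ('w, 'p) model \<Rightarrow> 'w \<Rightarrow> 'p ml set" where
  "tp A M w = {\<alpha> \<in> A. wsat M w \<alpha>}"

lemma tp_subset [simp]: "tp A M w \<subseteq> A" "tp A M ` T \<subseteq> Pow A"
  by (auto simp: tp_def)

text \<open>The characteristic (Hintikka) formula of a type.\<close>
definition char_fml :: "'p ml set \<Rightarrow> 'p ml set \<Rightarrow> 'p ml" where
  "char_fml A t = bigand (t \<union> CNeg ` (A - t))"

lemma wsat_char_fml: "finite A \<Longrightarrow> t \<subseteq> A \<Longrightarrow> wsat M w (char_fml A t) \<longleftrightarrow> tp A M w = t"
  by (auto simp: char_fml_def wsat_bigand finite_subset tp_def ball_Un)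

definition support :: "'p ml set \<Rightarrow> 'p ml set set \<Rightarrow> 'p ml" where
  "support A S = bigor (char_fml A ` S)"

lemma wsat_support:
  assumes "finite A" "S \<subseteq> Pow A"
  shows "wsat M w (support A S) \<longleftrightarrow> tp A M w \<in> S"
proof -
  have "finite S" using assms by (meson finite_Pow_iff finite_subset)
  then have "wsat M w (support A S) \<longleftrightarrow> (\<exists>t\<in>S. wsat M w (char_fml A t))"
    by (simp add: support_def wsat_bigor)
  moreover have "wsat M w (char_fml A t) \<longleftrightarrow> tp A M w = t" if "t \<in> S" for t
    using assms that by (intro wsat_char_fml) auto
  ultimately show ?thesis by auto
qed

text \<open>
  The diagram for a set \<open>S\<close> of types says that exactly the types in \<open>S\<close> occur. Its negative part is kept
  apart because it is classical, and so may stay in force when a disjunction is eliminated.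
\<close>
definition excluded :: "'p ml set \<Rightarrow> 'p ml set set \<Rightarrow> 'p ml set" where
  "excluded A S = (\<lambda>t. CNeg (char_fml A t)) ` (Pow A - S)"

definition diagram :: "'p ml set \<Rightarrow> 'p ml set set \<Rightarrow> 'p mli set" where
  "diagram A S = (\<lambda>t. occ (char_fml A t)) ` S \<union> cl ` excluded A S"

lemma finite_diagram: "finite A \<Longrightarrow> S \<subseteq> Pow A \<Longrightarrow> finite (diagram A S)"
  by (auto simp: diagram_def excluded_def intro: finite_subset)

text \<open>If all types outside \<open>S\<close> are refuted at a world, then its own type belongs to \<open>S\<close>.\<close>
lemma excluded_classical:
  fixes \<alpha> :: "'p ml"
  assumes A: "finite A" and "\<And>(M :: ('p ml set, 'p) model) w. tp A M w \<in> S \<Longrightarrow> wsat M w \<alpha>"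
  shows "cl ` excluded A S \<turnstile> cl \<alpha>"
proof (rule classical_completeness)
  fix M :: "('p ml set, 'p) model" and w
  assume ex: "\<And>\<delta>. \<delta> \<in> excluded A S \<Longrightarrow> wsat M w \<delta>"
  have "tp A M w \<in> S"
  proof (rule ccontr)
    assume "tp A M w \<notin> S"
    then have "CNeg (char_fml A (tp A M w)) \<in> excluded A S" by (simp add: excluded_def)
    then show False using ex wsat_char_fml[OF A tp_subset(1), of M w M w] by fastforce
  qed
  then show "wsat M w \<alpha>" by (rule assms(2))
qed

lemma diagram_classical:
  fixes \<alpha> :: "'p ml"
  assumes "finite A" and "\<And>(M :: ('p ml set, 'p) model) w. tp A M w \<in> S \<Longrightarrow> wsat M w \<alpha>"
  shows "diagram A S \<turnstile> cl \<alpha>"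
  using derives_mono[OF excluded_classical[OF assms]] by (auto simp: diagram_def)

lemma diagram_occ:
  fixes \<alpha> :: "'p ml"
  assumes "finite A" "t \<in> S" "t \<subseteq> A"
    and "\<And>(M :: ('p ml set, 'p) model) w. tp A M w = t \<Longrightarrow> wsat M w \<alpha>"
  shows "diagram A S \<turnstile> occ \<alpha>"
proof (rule occ_mono)
  show "diagram A S \<turnstile> occ (char_fml A t)" using assms(2) by (auto simp: diagram_def intro: derives.Assm)
qed (simp add: wsat_char_fml[OF assms(1,3)] assms(4))

lemma diagram_intro:
  assumes A: "finite A" "S \<subseteq> Pow A" and "\<Gamma> \<turnstile> cl (support A S)"
    and "\<And>t. t \<in> S \<Longrightarrow> \<Gamma> \<turnstile> occ (char_fml A t)" and "\<delta> \<in> diagram A S"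
  shows "\<Gamma> \<turnstile> \<delta>"
proof -
  have "\<Gamma> \<turnstile> cl (CNeg (char_fml A t))" if t: "t \<in> Pow A - S" for t
  proof (rule cut_single[OF assms(3) classical_consequence])
    fix M :: "('a ml set, 'a) model" and w
    show "wsat M w (support A S) \<Longrightarrow> wsat M w (CNeg (char_fml A t))"
      using t wsat_support[OF A, of M w] wsat_char_fml[OF A(1), of t M w] by auto
  qed
  then show ?thesis using assms(4,5) by (auto simp: diagram_def excluded_def)
qed

text \<open>
  Case distinction on the set of types that occur, one application of \<open>occ_split\<close> per type. The
  induction deals with an arbitrary finite \<open>B\<close> in place of all types.
\<close>
lemma diagram_split:
  assumes "finite A" and "\<And>S. S \<subseteq> Pow A \<Longrightarrow> \<Gamma> \<union> diagram A S \<turnstile> \<chi>"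
  shows "\<Gamma> \<turnstile> \<chi>"
proof -
  let ?D = "\<lambda>B S. (\<lambda>t. occ (char_fml A t)) ` S \<union> (\<lambda>t. Neg (char_fml A t)) ` (B - S)"
  have gen: "(\<forall>S\<subseteq>B. \<Gamma> \<union> ?D B S \<turnstile> \<chi>) \<longrightarrow> \<Gamma> \<turnstile> \<chi>" if "finite B" for B \<Gamma>
    using that
  proof (induction B arbitrary: \<Gamma>)
    case (insert b B)
    show ?case
    proof (rule impI, rule occ_split[of "char_fml A b"])
      assume all: "\<forall>S\<subseteq>insert b B. \<Gamma> \<union> ?D (insert b B) S \<turnstile> \<chi>"
      have "insert (occ (char_fml A b)) \<Gamma> \<union> ?D B S \<turnstile> \<chi>" if S: "S \<subseteq> B" for S
      proof -
        have "\<Gamma> \<union> ?D (insert b B) (insert b S) \<turnstile> \<chi>" by (rule all[rule_format]) (use S in auto)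
        then show ?thesis by (rule derives_mono) blast
      qed
      then show "insert (occ (char_fml A b)) \<Gamma> \<turnstile> \<chi>" using insert.IH by simp
      have "insert (Neg (char_fml A b)) \<Gamma> \<union> ?D B S \<turnstile> \<chi>" if S: "S \<subseteq> B" for S
      proof -
        have "\<Gamma> \<union> ?D (insert b B) S \<turnstile> \<chi>" by (rule all[rule_format]) (use S in auto)
        then show ?thesis by (rule derives_mono) blast
      qed
      then show "insert (Neg (char_fml A b)) \<Gamma> \<turnstile> \<chi>" using insert.IH by simp
    qed
  qed simp
  have "diagram A S = ?D (Pow A) S" for S by (simp add: diagram_def excluded_def image_image)
  then show ?thesis using gen[of "Pow A" \<Gamma>] assms by auto
qed

text \<open>
  The formula in braces is what the two distribution rules produce. Its disjunction repeats types that
  \<open>support\<close> covers already, so it is equivalent to \<open>support\<close>, and with the atoms it gives the diagram.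
\<close>
lemma diagram_from_distr:
  assumes A: "finite A" "S \<subseteq> Pow A" and l: "set l = S" and "diagram A S \<turnstile> \<phi>"
  shows "{foldl And (foldl Or (cl (support A S)) (map (\<lambda>t. cl (char_fml A t)) l))
            (map (\<lambda>t. occ (char_fml A t)) l)} \<turnstile> \<phi>" (is "{?X} \<turnstile> \<phi>")
proof (rule cut[OF assms(4)])
  have "{?X} \<turnstile> ?X" by (simp add: derives.Assm)
  then have "{?X} \<turnstile> foldl Or (cl (support A S)) (map (\<lambda>t. cl (char_fml A t)) l)"
    and occs: "\<And>t. t \<in> S \<Longrightarrow> {?X} \<turnstile> occ (char_fml A t)"
    by (auto simp: derives_foldl_And l)
  then have 1: "{?X} \<turnstile> cl (foldl COr (support A S) (map (char_fml A) l))"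
    by (simp add: foldl_Or_cl)
  have "{?X} \<turnstile> cl (support A S)"
    by (rule cut_single[OF 1 classical_consequence])
       (use A(2) in \<open>auto simp: wsat_foldl_COr l wsat_support[OF A] wsat_char_fml[OF A(1)]\<close>)
  then show "{?X} \<turnstile> \<sigma>" if "\<sigma> \<in> diagram A S" for \<sigma>
    by (rule diagram_intro[OF A _ occs that])
qed

text \<open>
  Distribution moves the atoms that hold of the whole team into the disjunct, so that a subteam
  described only by its possible types may be taken to realize all of them.
\<close>
lemma Or_diagram:
  assumes A: "finite A" "S \<subseteq> Pow A" and or: "\<Gamma> \<turnstile> Or (cl (support A S)) \<psi>"
    and occs: "\<And>t. t \<in> S \<Longrightarrow> \<Gamma> \<turnstile> occ (char_fml A t)" and "diagram A S \<turnstile> \<phi>"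
  shows "\<Gamma> \<turnstile> Or \<phi> \<psi>"
proof -
  have "finite S" using A by (meson finite_Pow_iff finite_subset)
  then obtain l where l: "set l = S" using finite_list by blast
  let ?X = "foldl And (foldl Or (cl (support A S)) (map (\<lambda>t. cl (char_fml A t)) l))
            (map (\<lambda>t. occ (char_fml A t)) l)"
  let ?L = "map (\<lambda>t. ([True], [char_fml A t])) l"
  have "\<Gamma> \<turnstile> Or (foldl And (foldl Or (cl (support A S)) (map (\<lambda>(xs, a). cl (sgns a xs)) ?L))
            (map (\<lambda>(xs, a). prim xs a) ?L)) \<psi>"
    by (rule derives.IncDistr[OF _ or]) (use occs l in auto)
  then have "\<Gamma> \<turnstile> Or ?X \<psi>" by (simp add: comp_def)
  then show ?thesis
    by (rule derives.OrE[of "{}", rotated])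
       (auto intro: derives.OrI1 derives.OrI2 derives.Assm diagram_from_distr[OF A l assms(5)])
qed

text \<open>
  The analogue for successor teams: a type that is reachable from some world of the team may be added
  to any successor team whose description admits it.
\<close>
lemma Dia_diagram:
  assumes A: "finite A" "S \<subseteq> Pow A" and dia: "\<Gamma> \<turnstile> Dia (cl (support A S))"
    and occs: "\<And>t. t \<in> S \<Longrightarrow> \<Gamma> \<turnstile> occ (CDia (char_fml A t))" and "diagram A S \<turnstile> \<phi>"
  shows "\<Gamma> \<turnstile> Dia \<phi>"
proof -
  have "finite S" using A by (meson finite_Pow_iff finite_subset)
  then obtain l where l: "set l = S" using finite_list by blast
  let ?X = "foldl And (foldl Or (cl (support A S)) (map (\<lambda>t. cl (char_fml A t)) l))
            (map (\<lambda>t. occ (char_fml A t)) l)"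
  let ?L = "map (\<lambda>t. (True, char_fml A t)) l"
  have "\<Gamma> \<turnstile> Dia (foldl And (foldl Or (cl (support A S)) (map (\<lambda>(x, \<alpha>). cl (sgn1 \<alpha> x)) ?L))
            (map (\<lambda>(x, \<alpha>). incl [tf x] [\<alpha>]) ?L))"
    by (rule derives.IncDiaDistr[OF dia]) (use occs l in \<open>auto simp: tf_def\<close>)
  then have "\<Gamma> \<turnstile> Dia ?X" by (simp add: comp_def tf_def sgn1_def)
  then show ?thesis
    using derives.DiaMon[OF diagram_from_distr[OF A l assms(5)]] by blast
qed

text \<open>
  The atoms of the diagram are boxed by the exchange of \<open>\<diamond>\<close> and \<open>\<box>\<close>; the rest is classical.
\<close>
lemma Box_diagram:
  assumes A: "finite A" "S \<subseteq> Pow A" and box: "\<Gamma> \<turnstile> Box (cl (support A S))"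
    and occs: "\<And>t. t \<in> S \<Longrightarrow> \<Gamma> \<turnstile> occ (CDia (char_fml A t))" and "\<delta> \<in> diagram A S"
  shows "\<Gamma> \<turnstile> Box \<delta>"
proof -
  let ?\<Phi> = "insert (cl (support A S)) ((\<lambda>t. occ (char_fml A t)) ` S)"
  have "?\<Phi> \<turnstile> \<delta>"
    by (rule diagram_intro[OF A _ _ assms(5)]) (auto intro: derives.Assm)
  moreover have "finite ?\<Phi>" using A by (simp add: finite_subset)
  moreover have "\<Gamma> \<turnstile> Box \<phi>" if "\<phi> \<in> ?\<Phi>" for \<phi>
    using that box occs derives.DiaBoxIncExc[of "[True]" "[_]" \<Gamma>] by auto
  ultimately show ?thesis using derives.BoxMon by blast
qed

text \<open>A single formula equivalent to the diagram, for use inside disjunctions and under modalities.\<close>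
definition scene :: "'p ml set \<Rightarrow> 'p ml set set \<Rightarrow> 'p mli" where
  "scene A S = foldl And (cl (support A S)) (map (\<lambda>t. occ (char_fml A t)) (SOME l. set l = S))"

lemma derives_scene:
  assumes "finite A" "S \<subseteq> Pow A"
  shows "\<Gamma> \<turnstile> scene A S \<longleftrightarrow> \<Gamma> \<turnstile> cl (support A S) \<and> (\<forall>t\<in>S. \<Gamma> \<turnstile> occ (char_fml A t))"
  using assms by (simp add: scene_def derives_foldl_And set_some_list finite_subset[of S "Pow A"])

lemma derives_foldr_Or: "\<phi> \<in> set l \<Longrightarrow> \<Gamma> \<turnstile> \<phi> \<Longrightarrow> \<Gamma> \<turnstile> foldr Or l Bot"
  by (induction l) (auto intro: derives.OrI1 derives.OrI2)

text \<open>
  Split on the set of types that occur: each listed set contributes its own disjunct, and every other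
  set is incompatible with \<open>\<phi>\<close>. Hence \<open>\<phi>\<close> is bounded by a disjunction of diagrams, which the
  distribution rule for \<open>\<diamond>\<close> can process although it cannot process \<open>\<phi>\<close>.
\<close>
lemma normal_form:
  assumes A: "finite A" and l: "\<And>S. S \<subseteq> Pow A \<Longrightarrow> S \<notin> set l \<Longrightarrow> insert \<phi> (diagram A S) \<turnstile> Bot"
  shows "{\<phi>} \<turnstile> foldr Or (map (scene A) l) Bot"
proof (rule diagram_split[OF A])
  fix S assume S: "S \<subseteq> Pow A"
  show "{\<phi>} \<union> diagram A S \<turnstile> foldr Or (map (scene A) l) Bot"
  proof (cases "S \<in> set l")
    case True
    have "diagram A S \<turnstile> cl (support A S)"
      by (rule diagram_classical[OF A]) (simp add: wsat_support[OF A S])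
    moreover have "diagram A S \<turnstile> occ (char_fml A t)" if "t \<in> S" for t
      using that by (auto simp: diagram_def intro: derives.Assm)
    ultimately have "{\<phi>} \<union> diagram A S \<turnstile> scene A S"
      unfolding derives_scene[OF A S] by (auto intro: derives_mono)
    then show ?thesis using True by (intro derives_foldr_Or[of "scene A S"]) auto
  next
    case False
    then show ?thesis using l[OF S] by (auto intro: derives_Bot)
  qed
qed

lemma Dia_foldr_Or:
  assumes "\<And>\<phi>. \<phi> \<in> set l \<Longrightarrow> cl ` \<Delta> \<union> {Dia \<phi>} \<turnstile> \<chi>"
  shows "cl ` \<Delta> \<union> {Dia (foldr Or l Bot)} \<turnstile> \<chi>"
  using assms
proof (induction l)
  case Nil
  have "{cl (CDia CBot)} \<turnstile> cl CBot" by (rule classical_consequence) simp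
  then show ?case by (auto intro: derives_Bot derives_mono)
next
  case (Cons \<phi> l)
  have "cl ` \<Delta> \<union> {Dia (foldr Or (\<phi> # l) Bot)} \<turnstile> Or (Dia \<phi>) (Dia (foldr Or l Bot))"
    by (rule derives.DiaOrDistr) (simp add: derives.Assm)
  then show ?case by (rule derives.OrE[of \<Delta>, rotated]) (use Cons in auto)
qed

text \<open>
  For disjunction and diamond, the witness for the union is the union of all subteams, or successor
  teams, that could serve as witnesses. The empty union gives the empty team property.
\<close>
lemma sat_Union: "(\<And>U. U \<in> \<U> \<Longrightarrow> sat M U \<phi>) \<Longrightarrow> sat M (\<Union>\<U>) \<phi>"
proof (induction \<phi> arbitrary: \<U>)
  case (Or \<phi> \<psi>)
  let ?A = "{A. A \<subseteq> \<Union>\<U> \<and> sat M A \<phi>}" and ?B = "{B. B \<subseteq> \<Union>\<U> \<and> sat M B \<psi>}"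
  have "sat M (\<Union>?A) \<phi>" by (rule Or.IH(1)) simp
  moreover have "sat M (\<Union>?B) \<psi>" by (rule Or.IH(2)) simp
  moreover have "\<Union>\<U> \<subseteq> \<Union>?A \<union> \<Union>?B"
  proof
    fix w assume "w \<in> \<Union>\<U>"
    then obtain U where U: "U \<in> \<U>" "w \<in> U" by blast
    obtain A B where "U = A \<union> B" "sat M A \<phi>" "sat M B \<psi>" using Or.prems[OF U(1)] by auto
    then show "w \<in> \<Union>?A \<union> \<Union>?B" using U by blast
  qed
  then have "\<Union>\<U> = \<Union>?A \<union> \<Union>?B" by blast
  ultimately show ?case unfolding sat.simps by (intro exI conjI)
next
  case (Dia \<phi>)
  let ?S = "{S. sat M S \<phi> \<and> (\<exists>U\<in>\<U>. succ_team (rel M) U S)}"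
  have "sat M (\<Union>?S) \<phi>" by (rule Dia.IH) simp
  moreover have "succ_team (rel M) (\<Union>\<U>) (\<Union>?S)"
  proof (rule succ_team_def[THEN iffD2], intro conjI subsetI)
    fix w assume "w \<in> \<Union>\<U>"
    then obtain U where U: "U \<in> \<U>" "w \<in> U" by blast
    obtain S where "succ_team (rel M) U S" "sat M S \<phi>" using Dia.prems[OF U(1)] by auto
    then show "w \<in> (rel M)\<inverse> `` \<Union>?S" using U unfolding succ_team_def by blast
  next
    fix v assume "v \<in> \<Union>?S"
    then obtain S U where "v \<in> S" "U \<in> \<U>" "S \<subseteq> rel M `` U" by (auto simp: succ_team_def)
    then show "v \<in> rel M `` \<Union>\<U>" by blast
  qed
  ultimately show ?case unfolding sat.simps by blast
next
  case (Box \<phi>)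
  have "rel M `` \<Union>\<U> = \<Union>((``) (rel M) ` \<U>)" by blast
  moreover have "sat M (\<Union>((``) (rel M) ` \<U>)) \<phi>"
    by (rule Box.IH) (use Box.prems in auto)
  ultimately show ?case by simp
next
  case (Inc \<alpha> \<beta> ps)
  show ?case unfolding sat.simps
  proof
    fix w assume "w \<in> \<Union>\<U>"
    then obtain U where U: "U \<in> \<U>" "w \<in> U" by blast
    with Inc[OF U(1)] obtain v where "v \<in> U"
      "\<forall>(\<gamma>, \<delta>)\<in>set ((\<alpha>, \<beta>) # ps). csat M {w} \<gamma> \<longleftrightarrow> csat M {v} \<delta>"
      unfolding sat.simps by blast
    then show "\<exists>v\<in>\<Union>\<U>. \<forall>(\<gamma>, \<delta>)\<in>set ((\<alpha>, \<beta>) # ps). csat M {w} \<gamma> \<longleftrightarrow> csat M {v} \<delta>"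
      using U(1) by blast
  qed
next
  case (And \<phi> \<psi>)
  have "sat M (\<Union>\<U>) \<phi>" by (rule And.IH(1)) (use And.prems in auto)
  moreover have "sat M (\<Union>\<U>) \<psi>" by (rule And.IH(2)) (use And.prems in auto)
  ultimately show ?case by simp
qed auto

lemma largest_satisfying_subteam:
  obtains U where "U \<subseteq> T" "sat M U \<phi>" "\<And>U'. U' \<subseteq> T \<Longrightarrow> sat M U' \<phi> \<Longrightarrow> U' \<subseteq> U"
proof
  show "sat M (\<Union>{U. U \<subseteq> T \<and> sat M U \<phi>}) \<phi>" by (rule sat_Union) simp
qed auto

section \<open>Diagrams decide formulas\<close>

definition decided :: "'p ml set \<Rightarrow> ('w, 'p) model \<Rightarrow> 'p mli \<Rightarrow> bool" where
  "decided A M \<phi> \<longleftrightarrow>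
    (\<forall>T. (sat M T \<phi> \<longrightarrow> diagram A (tp A M ` T) \<turnstile> \<phi>) \<and>
         (\<not> sat M T \<phi> \<longrightarrow> insert \<phi> (diagram A (tp A M ` T)) \<turnstile> Bot))"

lemma decidedI:
  assumes "\<And>T. sat M T \<phi> \<Longrightarrow> diagram A (tp A M ` T) \<turnstile> \<phi>"
    and "\<And>T. \<not> sat M T \<phi> \<Longrightarrow> insert \<phi> (diagram A (tp A M ` T)) \<turnstile> Bot"
  shows "decided A M \<phi>"
  using assms by (simp add: decided_def)

lemma decided_pos: "decided A M \<phi> \<Longrightarrow> sat M T \<phi> \<Longrightarrow> diagram A (tp A M ` T) \<turnstile> \<phi>"
  by (simp add: decided_def)

lemma decided_neg: "decided A M \<phi> \<Longrightarrow> \<not> sat M T \<phi> \<Longrightarrow> insert \<phi> (diagram A (tp A M ` T)) \<turnstile> Bot"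
  by (simp add: decided_def)

lemma diagram_refute:
  assumes "\<Gamma> \<turnstile> Neg (char_fml A t)" "t \<in> S" "diagram A S \<subseteq> \<Gamma>"
  shows "\<Gamma> \<turnstile> \<chi>"
proof (rule occ_Neg_contra[OF _ assms(1)])
  show "\<Gamma> \<turnstile> occ (char_fml A t)"
    using assms(2,3) by (auto simp: diagram_def intro!: derives.Assm)
qed

text \<open>
  The comparison reaches into models of another type of worlds because classical derivability is
  checked in those by \<open>classical_completeness\<close>.
\<close>
definition determines :: "'p ml set \<Rightarrow> ('w, 'p) model \<Rightarrow> 'p ml \<Rightarrow> bool" where
  "determines A M \<alpha> \<longleftrightarrow> (\<forall>(M' :: ('p ml set, 'p) model) w w'.
     tp A M w = tp A M' w' \<longrightarrow> (wsat M w \<alpha> \<longleftrightarrow> wsat M' w' \<alpha>))"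

lemma determinesD:
  fixes M' :: "('p ml set, 'p) model"
  shows "determines A M \<alpha> \<Longrightarrow> tp A M w = tp A M' w' \<Longrightarrow> wsat M w \<alpha> \<longleftrightarrow> wsat M' w' \<alpha>"
  by (simp add: determines_def)

lemma decided_cl:
  fixes M :: "('w, 'p) model"
  assumes A: "finite A" and det: "determines A M \<alpha>"
  shows "decided A M (cl \<alpha>)"
proof (rule decidedI)
  fix T assume "sat M T (cl \<alpha>)"
  then have T: "wsat M w \<alpha>" if "w \<in> T" for w using that by (simp add: sat_cl csat_flat)
  show "diagram A (tp A M ` T) \<turnstile> cl \<alpha>"
  proof (rule diagram_classical[OF A])
    fix M' :: "('p ml set, 'p) model" and w'
    assume "tp A M' w' \<in> tp A M ` T"
    then obtain w where "w \<in> T" "tp A M w = tp A M' w'" by auto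
    then show "wsat M' w' \<alpha>" using T determinesD[OF det] by blast
  qed
next
  fix T assume "\<not> sat M T (cl \<alpha>)"
  then obtain w where w: "w \<in> T" "\<not> wsat M w \<alpha>" by (auto simp: sat_cl csat_flat)
  have "{cl \<alpha>} \<turnstile> cl (CNeg (char_fml A (tp A M w)))"
  proof (rule classical_consequence)
    fix M' :: "('p ml set, 'p) model" and w'
    assume "wsat M' w' \<alpha>"
    then have "tp A M w \<noteq> tp A M' w'" using w(2) determinesD[OF det] by blast
    then show "wsat M' w' (CNeg (char_fml A (tp A M w)))" by (auto simp: wsat_char_fml[OF A])
  qed
  then have "insert (cl \<alpha>) (diagram A (tp A M ` T)) \<turnstile> Neg (char_fml A (tp A M w))"
    by (auto intro: derives_mono)
  then show "insert (cl \<alpha>) (diagram A (tp A M ` T)) \<turnstile> Bot"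
    by (rule diagram_refute[OF _ imageI[OF w(1)]]) auto
qed

text \<open>
  A satisfied inclusion is introduced by extension: each pattern \<open>xs\<close> of truth values either never
  arises for \<open>a\<close>, or arises for \<open>b\<close> at a world whose type the diagram declares to occur. A violated one is
  refuted by reduction at the pattern of a world for which no match exists.
\<close>
lemma decided_incl:
  fixes M :: "('w, 'p) model"
  assumes A: "finite A" and m: "matched a b"
    and det: "\<And>\<alpha>. \<alpha> \<in> set a \<union> set b \<Longrightarrow> determines A M \<alpha>"
  shows "decided A M (incl a b)"
proof -
  have len: "length a = length b" "a \<noteq> []" using m by (auto simp: matched_def)
  have sat: "sat M T (incl a b) \<longleftrightarrow> (\<forall>w\<in>T. \<exists>v\<in>T. map (wsat M w) a = map (wsat M v) b)" for T
  proof -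
    have "map (wsat M w) a = map (wsat M v) b \<longleftrightarrow> (\<forall>i<length a. wsat M w (a ! i) \<longleftrightarrow> wsat M v (b ! i))" for w v
      by (subst list_eq_iff_nth_eq) (simp add: len)
    then show ?thesis by (simp only: sat_incl[OF m] csat_flat) simp
  qed
  have det_map: "map (wsat M w) c = map (wsat M' w') c"
    if "set c \<subseteq> set a \<union> set b" "tp A M w = tp A M' w'"
    for c w w' and M' :: "('p ml set, 'p) model"
    using that(1) determinesD[OF det that(2)] by auto
  show ?thesis
  proof (rule decidedI)
    fix T assume T: "sat M T (incl a b)"
    let ?D = "diagram A (tp A M ` T)"
    have "?D \<turnstile> Or (Neg (sgns a xs)) (prim xs b)" if xs: "length xs = length a" for xs
    proof (cases "\<exists>w\<in>T. map (wsat M w) a = xs")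
      case True
      have mb: "matched xs b" using xs len by (auto simp: matched_def)
      obtain v where v: "v \<in> T" "map (wsat M v) b = xs" using True T sat by metis
      have "?D \<turnstile> occ (sgns b xs)"
      proof (rule diagram_occ[OF A imageI[OF v(1)]])
        show "wsat M' w' (sgns b xs)" if "tp A M' w' = tp A M v" for M' :: "('p ml set, 'p) model" and w'
          unfolding wsat_sgns[OF mb] using det_map[of b v M' w'] that v(2) by simp
      qed simp
      then show ?thesis using prim_iff_occ[OF mb] derives.OrI2 by blast
    next
      case False
      have ma: "matched xs a" using xs len by (auto simp: matched_def)
      have "?D \<turnstile> cl (CNeg (sgns a xs))"
      proof (rule diagram_classical[OF A])
        fix M' :: "('p ml set, 'p) model" and w'
        assume "tp A M' w' \<in> tp A M ` T"
        then obtain w where "w \<in> T" "tp A M w = tp A M' w'" by auto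
        then show "wsat M' w' (CNeg (sgns a xs))"
          unfolding wsat.simps wsat_sgns[OF ma] using False det_map[of a w M' w'] by auto
      qed
      then show ?thesis by (auto intro: derives.OrI1)
    qed
    then have all: "?D \<turnstile> \<phi>" if "\<phi> \<in> set (map (\<lambda>xs. Or (Neg (sgns a xs)) (prim xs b))
        (List.n_lists (length a) [True, False]))" for \<phi>
      using that by (auto simp: set_n_lists)
    have ne: "List.n_lists (length a) [True, False] \<noteq> []"
      using length_n_lists[of "length a" "[True, False]"] by auto
    have fold: "?D \<turnstile> foldl1 And l" if "l \<noteq> []" "\<And>\<phi>. \<phi> \<in> set l \<Longrightarrow> ?D \<turnstile> \<phi>" for l
      using that by (cases l) (auto simp: derives_foldl_And)
    show "?D \<turnstile> incl a b"
      by (rule derives.IncExt[OF m fold]) (use ne all in auto)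
  next
    fix T assume "\<not> sat M T (incl a b)"
    then obtain w where w: "w \<in> T" "\<And>v. v \<in> T \<Longrightarrow> map (wsat M w) a \<noteq> map (wsat M v) b"
      using sat by auto
    define xs where "xs = map (wsat M w) a"
    have ma: "matched xs a" and mb: "matched xs b" using len by (auto simp: matched_def xs_def)
    let ?S = "tp A M ` T" and ?t = "tp A M w"
    let ?G = "insert (incl a b) (diagram A ?S)"
    have neg: "cl ` excluded A ?S \<turnstile> cl (CNeg (sgns b xs))"
    proof (rule excluded_classical[OF A])
      fix M' :: "('p ml set, 'p) model" and w'
      assume "tp A M' w' \<in> ?S"
      then obtain v where "v \<in> T" "tp A M v = tp A M' w'" by auto
      then show "wsat M' w' (CNeg (sgns b xs))"
        unfolding wsat.simps wsat_sgns[OF mb] using w(2)[of v] det_map[of b v M' w'] by (auto simp: xs_def)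
    qed
    have nb: "cl ` excluded A ?S \<union> {prim xs b} \<turnstile> Neg (sgns a xs)"
      by (rule derives.IncNegE[OF mb]) (use derives_mono[OF neg] in \<open>auto intro: derives.Assm\<close>)
    have "?G \<turnstile> Neg (sgns a xs)"
    proof (rule derives.OrE[OF _ _ _ nb])
      show "?G \<turnstile> Or (Neg (sgns a xs)) (prim xs b)"
        by (rule derives.IncRdt[OF m ma]) (simp add: derives.Assm)
    qed (auto simp: diagram_def intro: derives.Assm)
    moreover have "?G \<turnstile> occ (sgns a xs)"
    proof (rule derives_mono[OF diagram_occ[OF A imageI[OF w(1)]]])
      show "wsat M' w' (sgns a xs)" if "tp A M' w' = ?t" for M' :: "('p ml set, 'p) model" and w'
        unfolding wsat_sgns[OF ma] using det_map[of a w M' w'] that by (simp add: xs_def)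
    qed auto
    ultimately show "?G \<turnstile> Bot" by (rule occ_Neg_contra[rotated])
  qed
qed

lemma decided_And:
  assumes "decided A M \<phi>" "decided A M \<psi>"
  shows "decided A M (And \<phi> \<psi>)"
proof (rule decidedI)
  fix T assume "sat M T (And \<phi> \<psi>)"
  then show "diagram A (tp A M ` T) \<turnstile> And \<phi> \<psi>"
    using assms by (auto intro: derives.AndI decided_pos)
next
  fix T assume "\<not> sat M T (And \<phi> \<psi>)"
  then obtain \<chi> where \<chi>: "\<chi> \<in> {\<phi>, \<psi>}" "\<not> sat M T \<chi>" by auto
  then have d: "insert \<chi> (diagram A (tp A M ` T)) \<turnstile> Bot" using assms decided_neg by blast
  have a: "insert (And \<phi> \<psi>) (diagram A (tp A M ` T)) \<turnstile> And \<phi> \<psi>" by (simp add: derives.Assm)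
  have "insert (And \<phi> \<psi>) (diagram A (tp A M ` T)) \<turnstile> \<chi>"
    using \<chi>(1) derives.AndE1[OF a] derives.AndE2[OF a] by auto
  then show "insert (And \<phi> \<psi>) (diagram A (tp A M ` T)) \<turnstile> Bot"
    by (intro cut[OF d]) (auto intro: derives.Assm)
qed

lemma type_image_filter: "S \<subseteq> tp A M ` T \<Longrightarrow> tp A M ` {w \<in> T. tp A M w \<in> S} = S"
  by auto

text \<open>
  Split on the set \<open>S\<close> of types. A set \<open>S\<close> within the types of \<open>T\<close> is realized by a subteam of \<open>T\<close>, and if
  it contains the type of \<open>w\<close> then this subteam contains \<open>w\<close>; so it violates \<open>\<phi>\<close>, and
  its diagram excludes \<open>\<phi>\<close>. The assumptions are \<open>\<phi>\<close> and otherwise classical, as the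
  elimination of disjunctions demands.
\<close>
lemma refute_type:
  assumes A: "finite A" and dec: "decided A M \<phi>" and w: "w \<in> T"
    and none: "\<And>U. U \<subseteq> T \<Longrightarrow> w \<in> U \<Longrightarrow> \<not> sat M U \<phi>"
  shows "cl ` excluded A (tp A M ` T) \<union> {\<phi>} \<turnstile> Neg (char_fml A (tp A M w))"
proof (rule diagram_split[OF A])
  let ?t = "tp A M w" and ?E = "cl ` excluded A (tp A M ` T) \<union> {\<phi>}"
  fix S assume S: "S \<subseteq> Pow A"
  show "?E \<union> diagram A S \<turnstile> Neg (char_fml A ?t)"
  proof (cases "S \<subseteq> tp A M ` T")
    case False
    then obtain s where s: "s \<in> S" "s \<notin> tp A M ` T" by blast
    then have "Neg (char_fml A s) \<in> ?E"
      using S by (force simp: excluded_def)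
    then have "?E \<union> diagram A S \<turnstile> Neg (char_fml A s)" by (auto intro: derives.Assm)
    then show ?thesis by (rule diagram_refute[OF _ s(1)]) blast
  next
    case sub: True
    show ?thesis
    proof (cases "?t \<in> S")
      case True
      have "\<not> sat M {v \<in> T. tp A M v \<in> S} \<phi>" by (rule none) (use w True in auto)
      from decided_neg[OF dec this] have "insert \<phi> (diagram A S) \<turnstile> Bot"
        by (simp add: type_image_filter[OF sub])
      then have "?E \<union> diagram A S \<turnstile> Bot" by (rule derives_mono) auto
      then show ?thesis by (rule derives_Bot)
    next
      case False
      then have "CNeg (char_fml A ?t) \<in> excluded A S" by (simp add: excluded_def)
      then show ?thesis by (force simp: diagram_def intro: derives.Assm)
    qed
  qed
qed

lemma derives_Or_comm: "\<Gamma> \<turnstile> Or \<phi> \<psi> \<Longrightarrow> \<Gamma> \<turnstile> Or \<psi> \<phi>"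
  by (rule derives.OrE[of "{}" _ \<phi> \<psi>]) (auto intro: derives.OrI1 derives.OrI2 derives.Assm)

text \<open>
  Positive half: the types of the two subteams cover all types, and distribution, used for either
  disjunct in turn, completes each to the diagram of its subteam. Negative half: some world
  lies in neither of the largest subteams that satisfy a disjunct, so both disjuncts refute its type.
\<close>
lemma decided_Or:
  assumes A: "finite A" and dec: "decided A M \<phi>" "decided A M \<psi>"
  shows "decided A M (Or \<phi> \<psi>)"
proof (rule decidedI)
  fix T assume "sat M T (Or \<phi> \<psi>)"
  then obtain T1 T2 where T: "T = T1 \<union> T2" "sat M T1 \<phi>" "sat M T2 \<psi>" by auto
  let ?S = "tp A M ` T" and ?S1 = "tp A M ` T1" and ?S2 = "tp A M ` T2"
  have occs: "diagram A ?S \<turnstile> occ (char_fml A t)" if "t \<in> ?S1 \<union> ?S2" for t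
    using that T(1) by (auto simp: diagram_def intro!: derives.Assm)
  have "diagram A ?S \<turnstile> cl (COr (support A ?S1) (support A ?S2))"
    by (rule diagram_classical[OF A]) (auto simp: wsat_support[OF A] T(1))
  then have "diagram A ?S \<turnstile> Or \<phi> (cl (support A ?S2))"
    by (intro Or_diagram[OF A _ _ occs decided_pos[OF dec(1) T(2)]]) auto
  then have "diagram A ?S \<turnstile> Or \<psi> \<phi>"
    by (intro Or_diagram[OF A _ derives_Or_comm occs decided_pos[OF dec(2) T(3)]]) auto
  then show "diagram A ?S \<turnstile> Or \<phi> \<psi>" by (rule derives_Or_comm)
next
  fix T assume ns: "\<not> sat M T (Or \<phi> \<psi>)"
  obtain U1 where U1: "U1 \<subseteq> T" "sat M U1 \<phi>" "\<And>U. U \<subseteq> T \<Longrightarrow> sat M U \<phi> \<Longrightarrow> U \<subseteq> U1"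
    using largest_satisfying_subteam by blast
  obtain U2 where U2: "U2 \<subseteq> T" "sat M U2 \<psi>" "\<And>U. U \<subseteq> T \<Longrightarrow> sat M U \<psi> \<Longrightarrow> U \<subseteq> U2"
    using largest_satisfying_subteam by blast
  have "T \<noteq> U1 \<union> U2" using ns U1(2) U2(2) by auto
  then obtain w where w: "w \<in> T" "w \<notin> U1" "w \<notin> U2" using U1(1) U2(1) by blast
  let ?S = "tp A M ` T" and ?t = "tp A M w"
  let ?G = "insert (Or \<phi> \<psi>) (diagram A ?S)"
  have "cl ` excluded A ?S \<union> {\<phi>} \<turnstile> Neg (char_fml A ?t)"
    by (rule refute_type[OF A dec(1) w(1)]) (use U1(3) w(2) in blast)
  moreover have "cl ` excluded A ?S \<union> {\<psi>} \<turnstile> Neg (char_fml A ?t)"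
    by (rule refute_type[OF A dec(2) w(1)]) (use U2(3) w(3) in blast)
  ultimately have "?G \<turnstile> Neg (char_fml A ?t)"
    by (rule derives.OrE[rotated 2]) (auto simp: diagram_def intro: derives.Assm)
  then show "?G \<turnstile> Bot"
    by (rule diagram_refute[OF _ imageI[OF w(1)]]) auto
qed

text \<open>Types over \<open>A'\<close> tell which types over \<open>A\<close> are seen by a world.\<close>
definition refines :: "'p ml set \<Rightarrow> 'p ml set \<Rightarrow> bool" where
  "refines A' A \<longleftrightarrow> finite A \<and> finite A' \<and> (\<forall>t\<subseteq>A. CDia (char_fml A t) \<in> A')"

lemma tp_eqD: "tp A M w = tp A M' w' \<Longrightarrow> \<alpha> \<in> A \<Longrightarrow> wsat M w \<alpha> \<longleftrightarrow> wsat M' w' \<alpha>"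
  unfolding tp_def by blast

lemma successor_types:
  assumes "refines A' A" "tp A' M w = tp A' M' w'" "(w, v) \<in> rel M"
  shows "\<exists>v'. (w', v') \<in> rel M' \<and> tp A M' v' = tp A M v"
proof -
  let ?\<alpha> = "CDia (char_fml A (tp A M v))"
  have A: "finite A" and mem: "?\<alpha> \<in> A'" using assms(1) by (auto simp: refines_def)
  have "wsat M w ?\<alpha>" using assms(3) by (auto simp: wsat_char_fml[OF A])
  then have "wsat M' w' ?\<alpha>" using tp_eqD[OF assms(2) mem] by blast
  then show ?thesis by (auto simp: wsat_char_fml[OF A])
qed

lemma diagram_occ_Dia:
  fixes M :: "('w, 'p) model"
  assumes ref: "refines A' A" and v: "v \<in> rel M `` T"
  shows "diagram A' (tp A' M ` T) \<turnstile> occ (CDia (char_fml A (tp A M v)))"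
proof -
  have A: "finite A" "finite A'" using ref by (auto simp: refines_def)
  obtain w where w: "w \<in> T" "(w, v) \<in> rel M" using v by blast
  show ?thesis
  proof (rule diagram_occ[OF A(2) imageI[OF w(1)]])
    fix M' :: "('p ml set, 'p) model" and w'
    assume "tp A' M' w' = tp A' M w"
    from successor_types[OF ref this[symmetric] w(2)]
    show "wsat M' w' (CDia (char_fml A (tp A M v)))" by (auto simp: wsat_char_fml[OF A(1)])
  qed simp
qed

text \<open>
  Positive half: the types of a satisfying successor team are all reachable, so \<open>Dia_diagram\<close> applies.
  Negative half: some world \<open>w\<close> of \<open>T\<close> has no successor in the largest satisfying team \<open>U\<close> of successors of
  \<open>T\<close>. By the normal form, \<open>\<diamond>\<phi>\<close> is bounded by the \<open>\<diamond>\<close> of the diagrams of two kinds of \<open>S\<close>, and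
  each of these refutes the type of \<open>w\<close>. If \<open>S\<close> has a type not seen from \<open>T\<close>, the diagram of \<open>T\<close> forbids it.
  Otherwise the successors of \<open>T\<close> with types in \<open>S\<close> satisfy \<open>\<phi>\<close>, hence lie in \<open>U\<close>, and \<open>w\<close> sees none of them.
\<close>
lemma decided_Dia:
  fixes M :: "('w, 'p) model"
  assumes ref: "refines A' A" and dec: "decided A M \<phi>"
  shows "decided A' M (Dia \<phi>)"
proof (rule decidedI)
  have A: "finite A" "finite A'" using ref by (auto simp: refines_def)
  {
    fix T assume "sat M T (Dia \<phi>)"
    then obtain S where S: "succ_team (rel M) T S" "sat M S \<phi>" by auto
    let ?D = "diagram A' (tp A' M ` T)"
    have "?D \<turnstile> cl (CDia (support A (tp A M ` S)))"
    proof (rule diagram_classical[OF A(2)])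
      fix M' :: "('p ml set, 'p) model" and w'
      assume "tp A' M' w' \<in> tp A' M ` T"
      then obtain w where w: "w \<in> T" "tp A' M w = tp A' M' w'" by auto
      obtain v where v: "v \<in> S" "(w, v) \<in> rel M"
        using S(1) w(1) unfolding succ_team_def by blast
      from successor_types[OF ref w(2) v(2)]
      show "wsat M' w' (CDia (support A (tp A M ` S)))"
        using v(1) by (auto simp: wsat_support[OF A(1)])
    qed
    moreover have "?D \<turnstile> occ (CDia (char_fml A t))" if "t \<in> tp A M ` S" for t
    proof -
      obtain v where v: "v \<in> S" "t = tp A M v" using \<open>t \<in> tp A M ` S\<close> by blast
      have "v \<in> rel M `` T" using v(1) S(1) unfolding succ_team_def by blast
      then show ?thesis unfolding v(2) by (rule diagram_occ_Dia[OF ref])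
    qed
    ultimately show "?D \<turnstile> Dia \<phi>"
      by (intro Dia_diagram[OF A(1) _ _ _ decided_pos[OF dec S(2)]]) auto
  next
    fix T assume ns: "\<not> sat M T (Dia \<phi>)"
    obtain U where U: "U \<subseteq> rel M `` T" "sat M U \<phi>"
      "\<And>U'. U' \<subseteq> rel M `` T \<Longrightarrow> sat M U' \<phi> \<Longrightarrow> U' \<subseteq> U"
      using largest_satisfying_subteam by blast
    have "\<not> succ_team (rel M) T U" using ns U(2) by auto
    then obtain w where w: "w \<in> T" "\<And>v. (w, v) \<in> rel M \<Longrightarrow> v \<notin> U"
      using U(1) unfolding succ_team_def by blast
    let ?R = "tp A M ` (rel M `` T)" and ?t = "tp A' M w" and ?E = "excluded A' (tp A' M ` T)"
    let ?G = "insert (Dia \<phi>) (diagram A' (tp A' M ` T))"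
    \<comment> \<open>the two kinds of \<open>S\<close>; every other \<open>S\<close> is the type set of a team that violates \<open>\<phi>\<close>\<close>
    define \<S> where "\<S> = {S. S \<subseteq> Pow A \<and>
      (S \<subseteq> ?R \<longrightarrow> sat M {v \<in> rel M `` T. tp A M v \<in> S} \<phi>)}"
    have "\<S> \<subseteq> Pow (Pow A)" by (auto simp: \<S>_def)
    then have "finite \<S>" by (rule finite_subset) (simp add: A)
    then obtain l where l: "set l = \<S>" using finite_list by blast
    have "{\<phi>} \<turnstile> foldr Or (map (scene A) l) Bot"
    proof (rule normal_form[OF A(1)])
      fix S assume S: "S \<subseteq> Pow A" "S \<notin> set l"
      then have sub: "S \<subseteq> ?R" and "\<not> sat M {v \<in> rel M `` T. tp A M v \<in> S} \<phi>"
        by (auto simp: l \<S>_def)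
      from decided_neg[OF dec this(2)] show "insert \<phi> (diagram A S) \<turnstile> Bot"
        by (simp only: type_image_filter[OF sub])
    qed
    then have disj: "?G \<turnstile> Dia (foldr Or (map (scene A) l) Bot)"
      by (rule derives.DiaMon) (simp add: derives.Assm)
    have "cl ` ?E \<union> {Dia (foldr Or (map (scene A) l) Bot)} \<turnstile> Neg (char_fml A' ?t)"
    proof (rule Dia_foldr_Or)
      fix \<theta> assume "\<theta> \<in> set (map (scene A) l)"
      then obtain S where S: "S \<in> \<S>" "\<theta> = scene A S" using l by auto
      have SA: "S \<subseteq> Pow A" using S(1) by (simp add: \<S>_def)
      have dia: "cl ` ?E \<union> {Dia \<theta>} \<turnstile> Dia \<theta>" by (simp add: derives.Assm)
      have "{\<theta>} \<turnstile> \<theta>" by (simp add: derives.Assm)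
      then have supp: "{\<theta>} \<turnstile> cl (support A S)" and occs: "\<And>t. t \<in> S \<Longrightarrow> {\<theta>} \<turnstile> occ (char_fml A t)"
        by (simp_all add: S(2) derives_scene[OF A(1) SA])
      show "cl ` ?E \<union> {Dia \<theta>} \<turnstile> Neg (char_fml A' ?t)"
      proof (cases "S \<subseteq> ?R")
        case False
        then obtain s where s: "s \<in> S" "s \<notin> ?R" by blast
        have "cl ` ?E \<union> {Dia \<theta>} \<turnstile> Dia (prim [True] [char_fml A s])"
          using derives.DiaMon[OF occs[OF s(1)] dia] by simp
        from derives.DiaIncDistr[OF _ this]
        have o: "cl ` ?E \<union> {Dia \<theta>} \<turnstile> occ (CDia (char_fml A s))" by simp
        have "cl ` ?E \<turnstile> cl (CNeg (CDia (char_fml A s)))"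
        proof (rule excluded_classical[OF A(2)])
          fix M' :: "('p ml set, 'p) model" and w'
          assume "tp A' M' w' \<in> tp A' M ` T"
          then obtain u where u: "u \<in> T" "tp A' M' w' = tp A' M u" by auto
          have "tp A M' v' \<noteq> s" if "(w', v') \<in> rel M'" for v'
            using successor_types[OF ref u(2) that] u(1) s(2) by blast
          then show "wsat M' w' (CNeg (CDia (char_fml A s)))"
            using SA s(1) by (auto simp: wsat_char_fml[OF A(1)])
        qed
        then have "cl ` ?E \<union> {Dia \<theta>} \<turnstile> Neg (CDia (char_fml A s))" by (auto intro: derives_mono)
        with o show ?thesis by (rule occ_Neg_contra)
      next
        case True
        then have "{v \<in> rel M `` T. tp A M v \<in> S} \<subseteq> U"
          using S(1) by (intro U(3)) (auto simp: \<S>_def)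
        then have noS: "tp A M v \<notin> S" if "(w, v) \<in> rel M" for v
          using that w by blast
        have "cl ` ?E \<union> {Dia \<theta>} \<turnstile> cl (CDia (support A S))"
          using derives.DiaMon[OF supp dia] by simp
        moreover have "{cl (CDia (support A S))} \<turnstile> cl (CNeg (char_fml A' ?t))"
        proof (rule classical_consequence)
          fix M' :: "('p ml set, 'p) model" and w'
          assume "wsat M' w' (CDia (support A S))"
          then obtain v' where v': "(w', v') \<in> rel M'" "tp A M' v' \<in> S"
            by (auto simp: wsat_support[OF A(1) SA])
          have "tp A' M' w' \<noteq> ?t" using successor_types[OF ref _ v'(1)] v'(2) noS by metis
          then show "wsat M' w' (CNeg (char_fml A' ?t))" by (simp add: wsat_char_fml[OF A(2)])
        qed
        ultimately have "cl ` ?E \<union> {Dia \<theta>} \<turnstile> cl (CNeg (char_fml A' ?t))" by (rule cut_single)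
        then show ?thesis by simp
      qed
    qed
    then have "?G \<turnstile> Neg (char_fml A' ?t)"
      by (rule cut) (use disj in \<open>auto simp: diagram_def intro: derives.Assm\<close>)
    then show "?G \<turnstile> Bot"
      by (rule diagram_refute[OF _ imageI[OF w(1)]]) auto
  }
qed

lemma diagram_Box:
  fixes M :: "('w, 'p) model"
  assumes ref: "refines A' A" and "\<delta> \<in> diagram A (tp A M ` (rel M `` T))"
  shows "diagram A' (tp A' M ` T) \<turnstile> Box \<delta>"
proof (rule Box_diagram[OF _ _ _ _ assms(2)])
  have A: "finite A" "finite A'" using ref by (auto simp: refines_def)
  show "finite A" by (fact A)
  have "diagram A' (tp A' M ` T) \<turnstile> cl (CBox (support A (tp A M ` (rel M `` T))))"
  proof (rule diagram_classical[OF A(2)])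
    fix M' :: "('p ml set, 'p) model" and w'
    assume "tp A' M' w' \<in> tp A' M ` T"
    then obtain w where w: "w \<in> T" "tp A' M' w' = tp A' M w" by auto
    have "tp A M' v' \<in> tp A M ` (rel M `` T)" if "(w', v') \<in> rel M'" for v'
      using successor_types[OF ref w(2) that] w(1) by (metis ImageI image_eqI)
    then show "wsat M' w' (CBox (support A (tp A M ` (rel M `` T))))"
      by (simp add: wsat_support[OF A(1)])
  qed
  then show "diagram A' (tp A' M ` T) \<turnstile> Box (cl (support A (tp A M ` (rel M `` T))))" by simp
next
  fix t assume "t \<in> tp A M ` (rel M `` T)"
  then obtain v where v: "v \<in> rel M `` T" "t = tp A M v" by blast
  show "diagram A' (tp A' M ` T) \<turnstile> occ (CDia (char_fml A t))"
    unfolding v(2) by (rule diagram_occ_Dia[OF ref v(1)])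
qed auto

text \<open>
  In the negative half the boxed diagram of the successors and \<open>\<box>\<phi>\<close> yield \<open>\<box>\<bottom>\<close>. There is a
  successor to contradict this, because the empty team satisfies every formula.
\<close>
lemma decided_Box:
  fixes M :: "('w, 'p) model"
  assumes ref: "refines A' A" and dec: "decided A M \<phi>"
  shows "decided A' M (Box \<phi>)"
proof (rule decidedI)
  have A: "finite A" "finite A'" using ref by (auto simp: refines_def)
  {
    fix T assume "sat M T (Box \<phi>)"
    then have "diagram A (tp A M ` (rel M `` T)) \<turnstile> \<phi>" by (auto intro: decided_pos[OF dec])
    from derives.BoxMon[OF finite_diagram[OF A(1) tp_subset(2)] this diagram_Box[OF ref]]
    show "diagram A' (tp A' M ` T) \<turnstile> Box \<phi>" .
  next
    fix T assume "\<not> sat M T (Box \<phi>)"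
    then have ns: "\<not> sat M (rel M `` T) \<phi>" by simp
    then have "rel M `` T \<noteq> {}" using sat_Union[of "{}" M \<phi>] by auto
    then obtain v where v: "v \<in> rel M `` T" by blast
    let ?D = "diagram A (tp A M ` (rel M `` T))" and ?G = "insert (Box \<phi>) (diagram A' (tp A' M ` T))"
    have "?G \<turnstile> Box Bot"
    proof (rule derives.BoxMon[OF _ decided_neg[OF dec ns]])
      show "finite (insert \<phi> ?D)" by (simp add: finite_diagram[OF A(1)])
      show "?G \<turnstile> Box \<delta>" if "\<delta> \<in> insert \<phi> ?D" for \<delta>
        using that derives_mono[OF diagram_Box[OF ref, of \<delta> M T], of ?G]
        by (auto intro: derives.Assm)
    qed
    then have "?G \<turnstile> cl (CBox CBot)" by simp
    moreover have "{cl (CBox CBot)} \<turnstile> cl (CNeg (CDia (char_fml A (tp A M v))))"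
      by (rule classical_consequence) simp
    ultimately have "?G \<turnstile> cl (CNeg (CDia (char_fml A (tp A M v))))" by (rule cut_single)
    moreover have "?G \<turnstile> occ (CDia (char_fml A (tp A M v)))"
      by (rule derives_mono[OF diagram_occ_Dia[OF ref v]]) auto
    ultimately show "?G \<turnstile> Bot" using occ_Neg_contra by fastforce
  }
qed

section \<open>Finite fragments of classical modal logic\<close>

text \<open>
  Agreement on \<open>frag X k\<close> amounts to bisimilarity up to depth \<open>k\<close> with respect to the symbols in \<open>X\<close>: level \<open>k + 1\<close>
  records the symbols that hold and the types of level \<open>k\<close> among the successors.
\<close>
primrec frag :: "'p set \<Rightarrow> nat \<Rightarrow> 'p ml set" where
  "frag X 0 = CProp ` X"
| "frag X (Suc k) = CProp ` X \<union> (\<lambda>t. CDia (char_fml (frag X k) t)) ` Pow (frag X k)"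

lemma finite_frag: "finite X \<Longrightarrow> finite (frag X k)"
  by (induction k) auto

lemma refines_frag: "finite X \<Longrightarrow> refines (frag X (Suc k)) (frag X k)"
  unfolding refines_def using finite_frag[of X k] finite_frag[of X "Suc k"] by auto

lemma CProp_frag: "p \<in> X \<Longrightarrow> CProp p \<in> frag X k"
  by (cases k) auto

primrec depth_ml :: "'p ml \<Rightarrow> nat" where
  "depth_ml (CProp p) = 0"
| "depth_ml CBot = 0"
| "depth_ml (CNeg \<alpha>) = depth_ml \<alpha>"
| "depth_ml (COr \<alpha> \<beta>) = max (depth_ml \<alpha>) (depth_ml \<beta>)"
| "depth_ml (CAnd \<alpha> \<beta>) = max (depth_ml \<alpha>) (depth_ml \<beta>)"
| "depth_ml (CDia \<alpha>) = Suc (depth_ml \<alpha>)"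
| "depth_ml (CBox \<alpha>) = Suc (depth_ml \<alpha>)"

primrec depth_mli :: "'p mli \<Rightarrow> nat" where
  "depth_mli (Prop p) = 0"
| "depth_mli Bot = 0"
| "depth_mli (Inc \<alpha> \<beta> ps) = Max (depth_ml ` ({\<alpha>, \<beta>} \<union> fst ` set ps \<union> snd ` set ps))"
| "depth_mli (Neg \<alpha>) = depth_ml \<alpha>"
| "depth_mli (Or \<phi> \<psi>) = max (depth_mli \<phi>) (depth_mli \<psi>)"
| "depth_mli (And \<phi> \<psi>) = max (depth_mli \<phi>) (depth_mli \<psi>)"
| "depth_mli (Dia \<phi>) = Suc (depth_mli \<phi>)"
| "depth_mli (Box \<phi>) = Suc (depth_mli \<phi>)"

lemma frag_type_agree:
  assumes "finite X" "depth_ml \<alpha> \<le> k" "set_ml \<alpha> \<subseteq> X" "tp (frag X k) M w = tp (frag X k) M' w'"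
  shows "wsat M w \<alpha> \<longleftrightarrow> wsat M' w' \<alpha>"
  using assms(2-)
proof (induction \<alpha> arbitrary: k w w')
  case (CProp p)
  then show ?case using tp_eqD[OF CProp(3) CProp_frag] by simp
next
  case (CDia \<alpha>)
  then obtain j where k: "k = Suc j" "depth_ml \<alpha> \<le> j" by (cases k) auto
  have "\<exists>v'. (w', v') \<in> rel M' \<and> wsat M' v' \<alpha>" if "(w, v) \<in> rel M" "wsat M v \<alpha>" for v
    using successor_types[OF refines_frag[OF assms(1)] CDia.prems(3)[unfolded k(1)] that(1)]
      CDia.IH[OF k(2)] CDia.prems(2) that(2) by (metis ml.set(6))
  moreover have "\<exists>v. (w, v) \<in> rel M \<and> wsat M v \<alpha>" if "(w', v') \<in> rel M'" "wsat M' v' \<alpha>" for v'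
    using successor_types[OF refines_frag[OF assms(1)] CDia.prems(3)[unfolded k(1), symmetric] that(1)]
      CDia.IH[OF k(2)] CDia.prems(2) that(2) by (metis ml.set(6))
  ultimately show ?case by auto
next
  case (CBox \<alpha>)
  then obtain j where k: "k = Suc j" "depth_ml \<alpha> \<le> j" by (cases k) auto
  have "wsat M' v' \<alpha>" if all: "\<forall>v. (w, v) \<in> rel M \<longrightarrow> wsat M v \<alpha>" and r: "(w', v') \<in> rel M'" for v'
    using successor_types[OF refines_frag[OF assms(1)] CBox.prems(3)[unfolded k(1), symmetric] r]
      CBox.IH[OF k(2)] CBox.prems(2) all by (metis ml.set(7))
  moreover have "wsat M v \<alpha>" if all: "\<forall>v'. (w', v') \<in> rel M' \<longrightarrow> wsat M' v' \<alpha>" and r: "(w, v) \<in> rel M" for v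
    using successor_types[OF refines_frag[OF assms(1)] CBox.prems(3)[unfolded k(1)] r]
      CBox.IH[OF k(2)] CBox.prems(2) all by (metis ml.set(7))
  ultimately show ?case by auto
next
  case (CNeg \<alpha>)
  then have "wsat M w \<alpha> \<longleftrightarrow> wsat M' w' \<alpha>" by (intro CNeg.IH[of k]) auto
  then show ?case by simp
next
  case (COr \<alpha> \<beta>)
  have "wsat M w \<alpha> \<longleftrightarrow> wsat M' w' \<alpha>" by (rule COr.IH(1)[of k]) (use COr.prems in auto)
  moreover have "wsat M w \<beta> \<longleftrightarrow> wsat M' w' \<beta>" by (rule COr.IH(2)[of k]) (use COr.prems in auto)
  ultimately show ?case by simp
next
  case (CAnd \<alpha> \<beta>)
  have "wsat M w \<alpha> \<longleftrightarrow> wsat M' w' \<alpha>" by (rule CAnd.IH(1)[of k]) (use CAnd.prems in auto)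
  moreover have "wsat M w \<beta> \<longleftrightarrow> wsat M' w' \<beta>" by (rule CAnd.IH(2)[of k]) (use CAnd.prems in auto)
  ultimately show ?case by simp
qed simp

lemma determines_frag: "finite X \<Longrightarrow> depth_ml \<alpha> \<le> k \<Longrightarrow> set_ml \<alpha> \<subseteq> X \<Longrightarrow> determines (frag X k) M \<alpha>"
  unfolding determines_def by (intro allI impI) (rule frag_type_agree)

lemma decided_frag:
  "finite X \<Longrightarrow> depth_mli \<phi> \<le> k \<Longrightarrow> set_mli \<phi> \<subseteq> X \<Longrightarrow> decided (frag X k) M \<phi>"
proof (induction \<phi> arbitrary: k)
  case (Prop p)
  have "decided (frag X k) M (cl (CProp p))"
    by (intro decided_cl finite_frag determines_frag) (use Prop in auto)
  then show ?case by simp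
next
  case Bot
  have "decided (frag X k) M (cl (CBot))"
    by (intro decided_cl finite_frag determines_frag) (use Bot in auto)
  then show ?case by simp
next
  case (Neg \<alpha>)
  have "decided (frag X k) M (cl (CNeg \<alpha>))"
    by (intro decided_cl finite_frag determines_frag) (use Neg in auto)
  then show ?case by simp
next
  case (Inc \<alpha> \<beta> ps)
  let ?a = "\<alpha> # map fst ps" and ?b = "\<beta> # map snd ps"
  have "Inc \<alpha> \<beta> ps = incl ?a ?b" by (simp add: incl_def zip_map_fst_snd)
  moreover have "decided (frag X k) M (incl ?a ?b)"
  proof (rule decided_incl[OF finite_frag[OF Inc.prems(1)]])
    show "matched ?a ?b" by (simp add: matched_def)
    fix \<gamma> assume g: "\<gamma> \<in> set ?a \<union> set ?b"
    then have "depth_ml \<gamma> \<le> k" using Inc.prems(2) by (auto simp: image_iff)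
    moreover have "set_ml \<alpha> \<union> set_ml \<beta> \<subseteq> X" "\<forall>p\<in>set ps. set_ml (fst p) \<union> set_ml (snd p) \<subseteq> X"
      using Inc.prems(3) by (simp_all add: prod_set_defs UN_subset_iff)
    then have "set_ml \<gamma> \<subseteq> X" using g by auto
    ultimately show "determines (frag X k) M \<gamma>" using determines_frag[OF Inc.prems(1)] by blast
  qed
  ultimately show ?case by simp
next
  case (Or \<phi> \<psi>) then show ?case by (auto intro!: decided_Or finite_frag)
next
  case (And \<phi> \<psi>) then show ?case by (auto intro!: decided_And)
next
  case (Dia \<phi>)
  then obtain j where k: "k = Suc j" "depth_mli \<phi> \<le> j" by (cases k) auto
  have "decided (frag X j) M \<phi>" using Dia k(2) by auto
  then show ?case unfolding k(1) by (rule decided_Dia[OF refines_frag[OF Dia.prems(1)]])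
next
  case (Box \<phi>)
  then obtain j where k: "k = Suc j" "depth_mli \<phi> \<le> j" by (cases k) auto
  have "decided (frag X j) M \<phi>" using Box k(2) by auto
  then show ?case unfolding k(1) by (rule decided_Box[OF refines_frag[OF Box.prems(1)]])
qed

lemma finite_set_ml: "finite (set_ml \<alpha>)"
  by (induction \<alpha>) auto

lemma finite_set_mli: "finite (set_mli \<phi>)"
  by (induction \<phi>) (auto simp: finite_set_ml prod_set_defs)

lemma some_fragment_decides: "\<exists>A. finite A \<and> decided A M \<phi>"
  using decided_frag[OF finite_set_mli order_refl order_refl] finite_frag[OF finite_set_mli] by blast

section \<open>Completeness\<close>

instance ml :: (countable) countable
  by countable_datatype

lemma countable_ml:
  assumes "countable (UNIV :: 'p set)"
  shows "countable (UNIV :: 'p ml set)"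
proof -
  obtain e :: "'p \<Rightarrow> nat" where "inj e" using assms countableE by blast
  then have "inj (map_ml e)" by (rule ml.inj_map)
  then have "inj (to_nat \<circ> map_ml e)" by (intro inj_compose inj_to_nat)
  then show ?thesis by (rule countableI)
qed

text \<open>
  Every world of \<open>W\<close> is reached from \<open>A\<close> by following witnesses along a finite list of formulas, and there
  are only countably many such lists.
\<close>
lemma countable_witnessed_mcs:
  fixes A :: "'p ml set set"
  assumes "countable (UNIV :: 'p set)" "countable A" "\<And>w. w \<in> A \<Longrightarrow> mcs w"
  obtains W where "A \<subseteq> W" "countable W" "witnessed W"
proof -
  define wit where "wit w \<alpha> = (if CDia \<alpha> \<in> w then SOME v. mcs v \<and> canon_rel w v \<and> \<alpha> \<in> v else w)"
    for w and \<alpha> :: "'p ml"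
  have wit: "mcs (wit w \<alpha>) \<and> canon_rel w (wit w \<alpha>) \<and> \<alpha> \<in> wit w \<alpha>" if "mcs w" "CDia \<alpha> \<in> w" for w \<alpha>
    using someI_ex[OF mcs_Dia_witness[OF that]] that(2) by (simp add: wit_def)
  have wit_mcs: "mcs (wit w \<alpha>)" if "mcs w" for w \<alpha>
    using wit[OF that] that by (cases "CDia \<alpha> \<in> w") (auto simp: wit_def)
  define W where "W = (\<lambda>(w, l). foldl wit w l) ` (A \<times> UNIV)"
  show thesis
  proof
    show "A \<subseteq> W" by (force simp: W_def intro: image_eqI[of _ _ "(_, [])"])
    have "countable (lists (UNIV :: 'p ml set))" using countable_ml[OF assms(1)] by (rule countable_lists)
    then show "countable W" using assms(2) by (simp add: W_def lists_UNIV)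
    have W: "mcs w" if "w \<in> W" for w
    proof -
      have "mcs (foldl wit w l)" if "mcs w" for w l
        using that by (induction l arbitrary: w) (auto simp: wit_mcs)
      then show ?thesis using \<open>w \<in> W\<close> assms(3) by (auto simp: W_def)
    qed
    have "\<exists>v\<in>W. canon_rel w v \<and> \<alpha> \<in> v" if w: "w \<in> W" and d: "CDia \<alpha> \<in> w" for w \<alpha>
    proof -
      obtain a l where "a \<in> A" "w = foldl wit a l" using w by (auto simp: W_def)
      then have "wit w \<alpha> \<in> W" by (force simp: W_def intro: image_eqI[of _ _ "(a, l @ [\<alpha>])"])
      then show ?thesis using wit[OF W[OF w] d] by blast
    qed
    then show "witnessed W" using W by (simp add: witnessed_def)
  qed
qed

text \<open>A formula that occurs is consistent with all classical consequences of the theory.\<close>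
lemma occ_realized:
  assumes "\<not> \<Gamma> \<turnstile> \<psi>" "\<Gamma> \<turnstile> occ \<alpha>"
  shows "\<exists>w. mcs w \<and> \<alpha> \<in> w \<and> {\<delta>. \<Gamma> \<turnstile> cl \<delta>} \<subseteq> w"
proof -
  let ?B = "{\<delta>. \<Gamma> \<turnstile> cl \<delta>}"
  have "\<not> cl ` insert \<alpha> ?B \<turnstile> Bot"
  proof
    assume "cl ` insert \<alpha> ?B \<turnstile> Bot"
    then have "cl ` ?B \<turnstile> Neg \<alpha>" by (intro derives.NegI[OF order_refl]) simp
    then have "\<Gamma> \<turnstile> Neg \<alpha>" by (rule cut) auto
    then show False using occ_Neg_contra[OF assms(2)] assms(1) by blast
  qed
  then show ?thesis using lindenbaum by (metis insert_subset)
qed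

definition complete_theory :: "'p mli set \<Rightarrow> bool" where
  "complete_theory \<Gamma> \<longleftrightarrow> (\<forall>\<alpha>. occ \<alpha> \<in> \<Gamma> \<or> Neg \<alpha> \<in> \<Gamma>)"

lemma complete_extension:
  assumes "\<not> \<Gamma> \<turnstile> \<psi>"
  obtains \<Gamma>' where "\<Gamma> \<subseteq> \<Gamma>'" "\<not> \<Gamma>' \<turnstile> \<psi>" "complete_theory \<Gamma>'"
proof -
  obtain \<Gamma>' where G: "\<Gamma> \<subseteq> \<Gamma>'" "\<not> \<Gamma>' \<turnstile> \<psi>" "\<And>\<Sigma>. \<Gamma>' \<subset> \<Sigma> \<Longrightarrow> \<Sigma> \<turnstile> \<psi>"
    using maximal_underivable[of "\<lambda>\<phi>. \<phi>" \<Gamma> \<psi>] assms by auto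
  have "occ \<alpha> \<in> \<Gamma>' \<or> Neg \<alpha> \<in> \<Gamma>'" for \<alpha>
  proof (rule ccontr)
    assume "\<not> (occ \<alpha> \<in> \<Gamma>' \<or> Neg \<alpha> \<in> \<Gamma>')"
    then have "insert (occ \<alpha>) \<Gamma>' \<turnstile> \<psi>" "insert (Neg \<alpha>) \<Gamma>' \<turnstile> \<psi>"
      by (auto intro!: G(3))
    then show False using occ_split G(2) by blast
  qed
  then show thesis using that G(1,2) by (simp add: complete_theory_def)
qed

text \<open>
  The team has one world for each \<open>\<alpha>\<close> with \<open>occ \<alpha>\<close> in \<open>\<Gamma>\<close>, containing \<open>\<alpha>\<close> and the classical consequences of \<open>\<Gamma>\<close>.
  Hence the formulas that hold at some world of the team are exactly those with \<open>occ \<alpha>\<close> in \<open>\<Gamma>\<close>.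
\<close>
lemma complete_theory_model:
  fixes \<Gamma> :: "'p mli set"
  assumes "countable (UNIV :: 'p set)" and "infinite (UNIV :: 'w set)"
    and nd: "\<not> \<Gamma> \<turnstile> \<psi>" and comp: "complete_theory \<Gamma>"
  obtains M :: "('w, 'p) model" and T where "kripke M" "T \<subseteq> worlds M"
    "\<And>A \<delta>. finite A \<Longrightarrow> \<delta> \<in> diagram A (tp A M ` T) \<Longrightarrow> \<delta> \<in> \<Gamma>"
proof -
  let ?O = "{\<alpha>. occ \<alpha> \<in> \<Gamma>}"
  have "\<forall>\<alpha>\<in>?O. \<exists>w. mcs w \<and> \<alpha> \<in> w \<and> {\<delta>. \<Gamma> \<turnstile> cl \<delta>} \<subseteq> w"
    using occ_realized[OF nd] by (auto intro: derives.Assm)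
  from bchoice[OF this] obtain g
    where "\<forall>\<alpha>\<in>?O. mcs (g \<alpha>) \<and> \<alpha> \<in> g \<alpha> \<and> {\<delta>. \<Gamma> \<turnstile> cl \<delta>} \<subseteq> g \<alpha>" by blast
  then have g: "mcs (g \<alpha>) \<and> \<alpha> \<in> g \<alpha> \<and> {\<delta>. \<Gamma> \<turnstile> cl \<delta>} \<subseteq> g \<alpha>" if "occ \<alpha> \<in> \<Gamma>" for \<alpha>
    using that by blast
  have cg: "countable (g ` ?O)" using countable_ml[OF assms(1)] by (meson countable_image countable_subset top_greatest)
  have mg: "mcs w" if "w \<in> g ` ?O" for w using that g by blast
  obtain W where W: "g ` ?O \<subseteq> W" "countable W" "witnessed W"
    by (rule countable_witnessed_mcs[OF assms(1) cg mg])
  obtain h :: "nat \<Rightarrow> 'w" where h: "inj h" using infinite_countable_subset[OF assms(2)] by blast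
  define f where "f = h \<circ> to_nat_on W"
  have f: "inj_on f W" unfolding f_def
    by (intro comp_inj_on inj_on_to_nat_on W(2)) (use h in \<open>auto intro: inj_on_subset\<close>)
  let ?M = "canon_model f W"
  let ?T = "f ` g ` ?O"
  have truth: "wsat ?M (f w) \<alpha> \<longleftrightarrow> \<alpha> \<in> w" if "w \<in> W" for w \<alpha>
    by (rule truth_lemma[OF W(3) f that])
  show thesis
  proof
    show "kripke ?M" by (rule kripke_canon_model)
    show "?T \<subseteq> worlds ?M" using W(1) by (auto simp: canon_model_def)
    fix A \<delta> assume A: "finite A" and "\<delta> \<in> diagram A (tp A ?M ` ?T)"
    then consider t where "t \<in> tp A ?M ` ?T" "\<delta> = occ (char_fml A t)"
      | t where "t \<subseteq> A" "t \<notin> tp A ?M ` ?T" "\<delta> = Neg (char_fml A t)"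
      by (auto simp: diagram_def excluded_def)
    then show "\<delta> \<in> \<Gamma>"
    proof cases
      case (1 t)
      then obtain \<alpha> where \<alpha>: "occ \<alpha> \<in> \<Gamma>" "t = tp A ?M (f (g \<alpha>))" by auto
      have W\<alpha>: "g \<alpha> \<in> W" using \<alpha>(1) W(1) by blast
      have "wsat ?M (f (g \<alpha>)) (char_fml A t)" unfolding \<alpha>(2) by (simp add: wsat_char_fml[OF A])
      then have "CNeg (char_fml A t) \<notin> g \<alpha>" using truth[OF W\<alpha>] mcs_Neg g[OF \<alpha>(1)] by blast
      then have "\<not> \<Gamma> \<turnstile> cl (CNeg (char_fml A t))" using g[OF \<alpha>(1)] by blast
      then have "Neg (char_fml A t) \<notin> \<Gamma>" using derives.Assm by force
      then show ?thesis using comp 1(2) by (auto simp: complete_theory_def)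
    next
      case (2 t)
      have "occ (char_fml A t) \<notin> \<Gamma>"
      proof
        assume o: "occ (char_fml A t) \<in> \<Gamma>"
        let ?w = "g (char_fml A t)"
        have "wsat ?M (f ?w) (char_fml A t)" using truth[of ?w] W(1) g[OF o] o by blast
        then have "tp A ?M (f ?w) = t" by (simp only: wsat_char_fml[OF A 2(1)])
        then show False using 2(2) o by blast
      qed
      then show ?thesis using comp 2(3) by (auto simp: complete_theory_def)
    qed
  qed
qed

theorem theorem4p13:
  fixes \<Gamma> :: "'p mli set" and \<psi> :: "'p mli"
  assumes "countable (UNIV :: 'p set)" and "infinite (UNIV :: 'p set)"
    and "infinite (UNIV :: 'w set)"
    and "entails TYPE('w) \<Gamma> \<psi>"
  shows "\<Gamma> \<turnstile> \<psi>"
proof (rule ccontr)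
  assume "\<not> \<Gamma> \<turnstile> \<psi>"
  then obtain \<Gamma>' where G: "\<Gamma> \<subseteq> \<Gamma>'" "\<not> \<Gamma>' \<turnstile> \<psi>" "complete_theory \<Gamma>'"
    by (rule complete_extension)
  obtain M :: "('w, 'p) model" and T where M: "kripke M" "T \<subseteq> worlds M"
    and diag: "\<And>A \<delta>. finite A \<Longrightarrow> \<delta> \<in> diagram A (tp A M ` T) \<Longrightarrow> \<delta> \<in> \<Gamma>'"
    using complete_theory_model[OF assms(1,3) G(2,3)] by metis
  have "sat M T \<gamma>" if "\<gamma> \<in> \<Gamma>" for \<gamma>
  proof (rule ccontr)
    assume ns: "\<not> sat M T \<gamma>"
    obtain A where A: "finite A" "decided A M \<gamma>" using some_fragment_decides by blast
    have "insert \<gamma> (diagram A (tp A M ` T)) \<subseteq> \<Gamma>'" using that G(1) diag[OF A(1)] by blast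
    from derives_mono[OF decided_neg[OF A(2) ns] this] show False
      using derives_Bot G(2) by blast
  qed
  then have s: "sat M T \<psi>" using assms(4) M unfolding entails_def by blast
  obtain A where A: "finite A" "decided A M \<psi>" using some_fragment_decides by blast
  have "diagram A (tp A M ` T) \<subseteq> \<Gamma>'" using diag[OF A(1)] by blast
  from derives_mono[OF decided_pos[OF A(2) s] this] show False using G(2) by blast
qed

end
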